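(* Take $0=\varepsilon_0<\varepsilon_1<\cdots<\varepsilon_m$ and let $f\colon\mathbb{R}^n\to\mathbb{R}$ be a Schwartz function such that: (i) $\hat f(0)\ge\operatorname{vol}B$, where $B\subseteq\mathbb{R}^n$ is the ball of radius $1/2$; (ii) $\hat f(u)\ge 0$ for all $u\in\mathbb{R}^n\setminus\{0\}$; (iii) $f(x)\le 0$ whenever $\|x\|\ge 1+\varepsilon_m$; (iv) $f(x)\le\eta_k$ whenever $\|x\|\in[1+\varepsilon_{k-1},1+\varepsilon_k)$, with $\eta_k\ge 0$, for $k=1,\dots,m$. Then the density of a sphere packing in $\mathbb{R}^n$ is at most the optimal value of the following linear programming problem in the variables $A_1,\dots,A_m$: $$\begin{array}{rll}\max & f(0)+\eta_1A_1+\cdots+\eta_mA_m & \\ & A_1+\cdots+A_k\le U(\varepsilon_k) & \text{for }k=1,\dots,m,\\ & A_i\ge 0 & \text{for }i=1,\dots,m,\end{array}$$ where $U(\varepsilon_k)\ge M(\varepsilon_k)$ for $k=1,\dots,m$.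
   Context: The Fourier transform is $\hat f(u)=\int_{\mathbb{R}^n}f(x)e^{-2\pi \mathrm{i}\,u\cdot x}\,dx$. A Schwartz function is an infinitely differentiable function such that any of its derivatives, multiplied by any power of the variables $x_1,\dots,x_n$, is bounded. A sphere packing is a union of equal-sized balls in $\mathbb{R}^n$ with pairwise disjoint interiors. Its density is the fraction of space covered by it: a packing $\mathcal{P}$ has density $\Delta$ if $\Delta=\lim_{r\to\infty}\operatorname{vol}(B(p,r)\cap\mathcal{P})/\operatorname{vol}B(p,r)$ for all $p\in\mathbb{R}^n$, where $B(p,r)$ is the ball of radius $r$ centered at $p$. Not every packing has a density, but every packing has an upper density $\limsup_{r\to\infty}\sup_{p\in\mathbb{R}^n}\operatorname{vol}(B(p,r)\cap\mathcal{P})/\operatorname{vol}B(p,r)$, and the supremum of the upper densities of packings is also achieved by periodic packings (those invariant under translation by a lattice), which do have a density. For $\varepsilon>0$ and a packing of balls of radius $1/2$ in $\mathbb{R}^n$, its $\varepsilon$-tangency graph is the graph whose vertices are the balls of the packing, two vertices being adjacent if the distance between the centers of the respective balls lies in the interval $[1,1+\varepsilon)$. $M(\varepsilon)$ denotes the least upper bound on the average degree of the $\varepsilon$-tangency graph of any sphere packing (by balls of radius $1/2$ in $\mathbb{R}^n$). *)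

theory Defs
  imports "HOL-Analysis.Analysis"
begin

definition partial_deriv :: "'n::finite \<Rightarrow> (real^'n \<Rightarrow> real) \<Rightarrow> real^'n \<Rightarrow> real" where
  "partial_deriv i f x = frechet_derivative f (at x) (axis i 1)"

definition partial_derivs :: "'n::finite list \<Rightarrow> (real^'n \<Rightarrow> real) \<Rightarrow> real^'n \<Rightarrow> real" where
  "partial_derivs is f = foldr partial_deriv is f"

text \<open>Infinite differentiability is expressed by requiring every iterated partial derivative
  to be (Frechet) differentiable everywhere; each such derivative is then continuous.\<close>

definition schwartz :: "(real^'n::finite \<Rightarrow> real) \<Rightarrow> bool" where
  "schwartz f \<longleftrightarrow>
     (\<forall>is x. partial_derivs is f differentiable (at x)) \<and>
     (\<forall>is \<alpha>. bounded (range (\<lambda>x. (\<Prod>i\<in>UNIV. (x $ i) ^ \<alpha> i) * partial_derivs is f x)))"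

definition fourier :: "(real^'n::finite \<Rightarrow> real) \<Rightarrow> real^'n \<Rightarrow> complex" where
  "fourier f u =
     (LINT x|lborel. complex_of_real (f x) * exp (- 2 * complex_of_real pi * \<i> * complex_of_real (u \<bullet> x)))"

text \<open>\<open>X\<close> is the set of centers of a packing by balls of radius \<open>\<rho>\<close>.\<close>

definition packing_centers :: "real \<Rightarrow> (real^'n::finite) set \<Rightarrow> bool" where
  "packing_centers \<rho> X \<longleftrightarrow>
     pairwise (\<lambda>x y. disjnt (interior (cball x \<rho>)) (interior (cball y \<rho>))) X"

definition sphere_packing :: "(real^'n::finite) set \<Rightarrow> bool" where
  "sphere_packing P \<longleftrightarrow> (\<exists>\<rho>>0. \<exists>X. packing_centers \<rho> X \<and> P = (\<Union>x\<in>X. cball x \<rho>))"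

definition covered_fraction :: "(real^'n::finite) set \<Rightarrow> real^'n \<Rightarrow> real \<Rightarrow> real" where
  "covered_fraction P p r = measure lborel (cball p r \<inter> P) / measure lborel (cball p r)"

definition has_density :: "(real^'n::finite) set \<Rightarrow> real \<Rightarrow> bool" where
  "has_density P \<Delta> \<longleftrightarrow> (\<forall>p. (covered_fraction P p \<longlongrightarrow> \<Delta>) at_top)"

definition upper_density :: "(real^'n::finite) set \<Rightarrow> ereal" where
  "upper_density P = Limsup at_top (\<lambda>r. SUP p. ereal (covered_fraction P p r))"

text \<open>In the \<open>\<epsilon>\<close>-tangency graph of a packing by balls of radius \<open>1/2\<close>, each ball is identified
  with its center.\<close>

definition tangency_adj :: "real \<Rightarrow> (real^'n::finite) set \<Rightarrow> real^'n \<Rightarrow> real^'n \<Rightarrow> bool" where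
  "tangency_adj \<epsilon> X x y \<longleftrightarrow> x \<in> X \<and> y \<in> X \<and> dist x y \<in> {1..<1 + \<epsilon>}"

definition tangency_degree :: "real \<Rightarrow> (real^'n::finite) set \<Rightarrow> real^'n \<Rightarrow> nat" where
  "tangency_degree \<epsilon> X x = card {y. tangency_adj \<epsilon> X x y}"

text \<open>The graph may be infinite, so its average degree is a limit of averages over large balls,
  in analogy with the density. For a nonempty finite packing it is the usual average, and for a
  periodic packing it is the average over one period.\<close>

definition has_average_degree :: "real \<Rightarrow> (real^'n::finite) set \<Rightarrow> real \<Rightarrow> bool" where
  "has_average_degree \<epsilon> X d \<longleftrightarrow>
     (\<forall>p. ((\<lambda>r. (\<Sum>x\<in>X \<inter> cball p r. real (tangency_degree \<epsilon> X x)) / real (card (X \<inter> cball p r)))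
            \<longlongrightarrow> d) at_top)"

text \<open>The least upper bound \<open>M(\<epsilon>)\<close> in dimension \<open>CARD('n)\<close>.\<close>

definition max_average_degree :: "'n::finite itself \<Rightarrow> real \<Rightarrow> ereal" where
  "max_average_degree _ \<epsilon> =
     Sup {ereal d | d. \<exists>X :: (real^'n) set. packing_centers (1/2) X \<and> has_average_degree \<epsilon> X d}"

definition lp_feasible :: "nat \<Rightarrow> (nat \<Rightarrow> real) \<Rightarrow> (real \<Rightarrow> real) \<Rightarrow> (nat \<Rightarrow> real) \<Rightarrow> bool" where
  "lp_feasible m \<epsilon> U A \<longleftrightarrow>
     (\<forall>k\<in>{1..m}. (\<Sum>i=1..k. A i) \<le> U (\<epsilon> k)) \<and> (\<forall>i\<in>{1..m}. 0 \<le> A i)"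

definition lp_optimal_value ::
  "nat \<Rightarrow> (nat \<Rightarrow> real) \<Rightarrow> (real \<Rightarrow> real) \<Rightarrow> (nat \<Rightarrow> real) \<Rightarrow> real \<Rightarrow> ereal" where
  "lp_optimal_value m \<epsilon> U \<eta> c =
     (SUP A\<in>{A. lp_feasible m \<epsilon> U A}. ereal (c + (\<Sum>i=1..m. \<eta> i * A i)))"

end

theory Submission
  imports Defs "HOL-Probability.Probability" "HOL-Real_Asymp.Real_Asymp"
begin

text \<open>
  Neither periodic packings nor Poisson summation are needed. By Gaussian regularization, a bounded
  continuous integrable function \<open>f\<close> with \<open>\<phi> = fourier f \<ge> 0\<close> is the inverse Fourier transform of the integrable
  function \<open>\<phi>\<close>, so its quadratic form is nonnegative on every finite signed measure. Apply this to the
  difference of the counting measure of the \<open>N\<close> centers in a ball of radius \<open>R\<close> and \<open>N/V\<close> times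
  Lebesgue measure on a concentric ball of radius \<open>R + T\<close> and volume \<open>V\<close>, where \<open>T \<rightarrow> \<infinity>\<close> and \<open>T = o(R)\<close>.
  This bounds the energy \<open>\<Sum>x. \<Sum>y. f (x - y)\<close> of the centers below by \<open>(N\<^sup>2/V) (fourier f 0 - o(1))\<close>.
  On the other hand, with \<open>A k\<close> the average number of centers in the \<open>k\<close>-th shell around a center,
  the energy is at most \<open>N (f 0 + \<Sum>k. \<eta> k * A k)\<close>, and \<open>A\<close> is feasible because a finite packing
  always has an average degree.
\<close>

subsection \<open>Product integrands, scaling and Schwartz functions\<close>

text \<open>Lebesgue measure is the image of the product of one-dimensional Lebesgue measures under
  \<open>?T\<close>, which rebuilds a point from its coordinates, so the product rule for product
  measures carries over. Values in a normed field cover both real Gaussians and their complex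
  Fourier integrands.\<close>

lemma
  fixes g :: "'a::euclidean_space \<Rightarrow> real \<Rightarrow> 'b::{real_normed_field,banach,second_countable_topology}"
  assumes g: "\<And>b. b \<in> Basis \<Longrightarrow> integrable lborel (g b)"
  shows integrable_lborel_prod: "integrable lborel (\<lambda>x::'a. \<Prod>b\<in>Basis. g b (x \<bullet> b))"
    and integral_lborel_prod:
      "(\<integral>x. (\<Prod>b\<in>Basis. g b ((x::'a) \<bullet> b)) \<partial>lborel) = (\<Prod>b\<in>Basis. integral\<^sup>L lborel (g b))"
proof -
  interpret product_sigma_finite "\<lambda>_::'a. lborel :: real measure" ..
  let ?T = "\<lambda>f::'a \<Rightarrow> real. \<Sum>b\<in>Basis. f b *\<^sub>R b"
  let ?P = "Pi\<^sub>M Basis (\<lambda>_::'a. lborel :: real measure)"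
  have T: "?T \<in> ?P \<rightarrow>\<^sub>M borel"
    by measurable
  have [measurable]: "\<And>b. b \<in> Basis \<Longrightarrow> g b \<in> borel_measurable borel"
    using borel_measurable_integrable[OF g] by simp
  have meas: "(\<lambda>x::'a. \<Prod>b\<in>Basis. g b (x \<bullet> b)) \<in> borel_measurable borel"
    by measurable
  have comp: "(\<Prod>b\<in>Basis. g b (?T h \<bullet> b)) = (\<Prod>b\<in>Basis. g b (h b))" for h
    by (intro prod.cong) (auto simp: inner_sum_left inner_Basis if_distrib cong: if_cong)
  have "integrable ?P (\<lambda>h. \<Prod>b\<in>Basis. g b (h b))"
    by (rule product_integrable_prod) (auto intro: g)
  then show "integrable lborel (\<lambda>x::'a. \<Prod>b\<in>Basis. g b (x \<bullet> b))"
    by (subst lborel_eq, subst integrable_distr_eq[OF T meas]) (simp add: comp)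
  show "(\<integral>x. (\<Prod>b\<in>Basis. g b ((x::'a) \<bullet> b)) \<partial>lborel) = (\<Prod>b\<in>Basis. integral\<^sup>L lborel (g b))"
    by (subst lborel_eq, subst integral_distr[OF T meas])
      (simp add: comp product_integral_prod g)
qed

text \<open>Change of variables \<open>y = t + c *\<^sub>R x\<close>. It serves to rescale Gaussians
  (\<open>c = 2 * pi * s\<close>), to center an average at \<open>x\<close> (\<open>c = s\<close>),
  and to reflect a translate (\<open>c = -1\<close>). The integral identity holds for non-integrable
  \<open>h\<close> too, both sides then being 0.\<close>

lemma
  fixes h :: "'a::euclidean_space \<Rightarrow> 'b::{banach,second_countable_topology}"
  assumes c: "c \<noteq> 0" and h[measurable]: "h \<in> borel_measurable borel"
  shows integrable_lborel_affine: "integrable lborel h \<longleftrightarrow> integrable lborel (\<lambda>x. h (t + c *\<^sub>R x))"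
    and integral_lborel_affine:
      "integral\<^sup>L lborel h = \<bar>c\<bar> ^ DIM('a) *\<^sub>R (\<integral>x. h (t + c *\<^sub>R x) \<partial>lborel)"
proof -
  have "integrable lborel (\<lambda>x. h (t + c *\<^sub>R x))"
    if "integrable lborel (\<lambda>x. \<bar>c\<bar> ^ DIM('a) *\<^sub>R h (t + c *\<^sub>R x))"
    using integrable_scaleR_right[OF that, of "inverse (\<bar>c\<bar> ^ DIM('a))"] c by simp
  then show "integrable lborel h \<longleftrightarrow> integrable lborel (\<lambda>x. h (t + c *\<^sub>R x))"
    by (subst lborel_affine[OF c, of t]) (auto simp: integrable_density integrable_distr_eq)
  show "integral\<^sup>L lborel h = \<bar>c\<bar> ^ DIM('a) *\<^sub>R (\<integral>x. h (t + c *\<^sub>R x) \<partial>lborel)"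
    by (subst lborel_affine[OF c, of t])
      (simp add: integral_density integral_distr c)
qed

section \<open>Decay and integrability of Schwartz functions\<close>

lemma schwartz_continuous:
  assumes "schwartz f"
  shows "continuous_on UNIV f"
proof -
  have "partial_derivs [] f differentiable (at x)" for x
    using assms unfolding schwartz_def by blast
  then show ?thesis
    by (auto simp: partial_derivs_def continuous_on_eq_continuous_at
        intro: differentiable_imp_continuous_within)
qed

lemma schwartz_bounded_monomial:
  assumes "schwartz f"
  shows "bounded (range (\<lambda>x. (\<Prod>i\<in>UNIV. (x $ i) ^ \<alpha> i) * f x))"
proof -
  have "bounded (range (\<lambda>x. (\<Prod>i\<in>UNIV. (x $ i) ^ \<alpha> i) * partial_derivs [] f x))"
    using assms unfolding schwartz_def by blast
  then show ?thesis
    by (simp add: partial_derivs_def)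
qed

lemma schwartz_bounded:
  assumes "schwartz f"
  shows "bounded (range f)"
  using schwartz_bounded_monomial[OF assms, of "\<lambda>_. 0"] by simp

text \<open>Expanding the product of the factors \<open>1 + (x $ i)\<^sup>2\<close> gives one
  monomial for each set \<open>S\<close> of coordinates, and each monomial times \<open>f\<close> is
  bounded. The majorant has product form, so its integrability reduces to dimension one.\<close>

lemma schwartz_decay:
  fixes f :: "real^'n::finite \<Rightarrow> real"
  assumes "schwartz f"
  obtains C where "\<And>x. \<bar>f x\<bar> \<le> C * (\<Prod>i\<in>UNIV. inverse (1 + (x $ i)\<^sup>2))"
proof -
  \<comment> \<open>The exponents are 2 on \<open>S\<close> and 0 elsewhere. There are finitely many
    \<open>S\<close>, so the bounds \<open>C S\<close> can be summed afterwards.\<close>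
  have "\<exists>C. \<forall>S x. \<bar>(\<Prod>i\<in>UNIV. (x $ i) ^ (if i \<in> S then 2 else 0)) * f x\<bar> \<le> C S"
  proof (intro choice allI)
    fix S
    obtain C where "\<forall>z \<in> range (\<lambda>x. (\<Prod>i\<in>UNIV. (x $ i) ^ (if i \<in> S then 2 else 0)) * f x). norm z \<le> C"
      using schwartz_bounded_monomial[OF assms, of "\<lambda>i. if i \<in> S then 2 else 0"]
      unfolding bounded_iff by blast
    then show "\<exists>C. \<forall>x. \<bar>(\<Prod>i\<in>UNIV. (x $ i) ^ (if i \<in> S then 2 else 0)) * f x\<bar> \<le> C"
      by auto
  qed
  then obtain C where C: "\<And>S x. \<bar>(\<Prod>i\<in>UNIV. (x $ i) ^ (if i \<in> S then 2 else 0)) * f x\<bar> \<le> C S"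
    by blast
  have "\<bar>f x\<bar> \<le> (\<Sum>S\<in>UNIV. C S) * (\<Prod>i\<in>UNIV. inverse (1 + (x $ i)\<^sup>2))" for x
  proof -
    have "(\<Prod>i\<in>UNIV. (x $ i)\<^sup>2 + 1) = (\<Sum>S\<in>UNIV. \<Prod>i\<in>UNIV. (x $ i) ^ (if i \<in> S then 2 else 0))"
      by (subst prod_add) (auto intro!: sum.cong prod.mono_neutral_cong_left)
    then have "\<bar>(\<Prod>i\<in>UNIV. (x $ i)\<^sup>2 + 1) * f x\<bar>
        \<le> (\<Sum>S\<in>UNIV. \<bar>(\<Prod>i\<in>UNIV. (x $ i) ^ (if i \<in> S then 2 else 0)) * f x\<bar>)"
      by (simp add: sum_distrib_right sum_abs)
    also have "\<dots> \<le> (\<Sum>S\<in>UNIV. C S)"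
      by (intro sum_mono C)
    finally have "(\<Prod>i\<in>UNIV. 1 + (x $ i)\<^sup>2) * \<bar>f x\<bar> \<le> (\<Sum>S\<in>UNIV. C S)"
      by (simp add: abs_mult abs_prod add.commute)
    moreover have "(\<Prod>i\<in>UNIV. 1 + (x $ i)\<^sup>2) > 0"
      by (intro prod_pos) (auto intro: add_pos_nonneg)
    moreover have "(\<Prod>i\<in>UNIV. inverse (1 + (x $ i)\<^sup>2)) = inverse (\<Prod>i\<in>UNIV. 1 + (x $ i)\<^sup>2)"
      using prod_inversef[of "\<lambda>i. 1 + (x $ i)\<^sup>2" UNIV] by (simp add: comp_def)
    ultimately show ?thesis
      by (simp add: divide_inverse[symmetric] pos_le_divide_eq mult.commute)
  qed
  then show ?thesis
    by (rule that)
qed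

lemma schwartz_integrable:
  fixes f :: "real^'n::finite \<Rightarrow> real"
  assumes "schwartz f"
  shows "integrable lborel f"
proof -
  obtain C where C: "\<And>x. \<bar>f x\<bar> \<le> C * (\<Prod>i\<in>UNIV. inverse (1 + (x $ i)\<^sup>2))"
    using schwartz_decay[OF assms] by blast
  have "integrable lborel (\<lambda>x::real. inverse (1 + x\<^sup>2))"
    using integrable_inverse_1_plus_square by (simp add: set_integrable_def)
  then have "integrable lborel (\<lambda>x::real^'n. \<Prod>b\<in>Basis. inverse (1 + (x \<bullet> b)\<^sup>2))"
    by (rule integrable_lborel_prod)
  moreover have "(\<Prod>b\<in>Basis. inverse (1 + (x \<bullet> b)\<^sup>2)) = (\<Prod>i\<in>UNIV. inverse (1 + (x $ i)\<^sup>2))"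
    for x :: "real^'n"
    by (simp add: Basis_vec_def UNION_singleton_eq_range inner_axis
        prod.reindex inj_on_def axis_eq_axis)
  ultimately have "integrable lborel (\<lambda>x::real^'n. C * (\<Prod>i\<in>UNIV. inverse (1 + (x $ i)\<^sup>2)))"
    by simp
  moreover have "f \<in> borel_measurable lborel"
    using schwartz_continuous[OF assms] by (simp add: borel_measurable_continuous_onI)
  ultimately show ?thesis
    by (rule Bochner_Integration.integrable_bound) (use C in \<open>auto intro: order.trans[OF _ abs_ge_self]\<close>)
qed

subsection \<open>Fourier inversion for nonnegative transforms\<close>

lemma gaussian_prod_Basis:
  fixes w :: "'a::euclidean_space"
  shows "exp (- ((norm w)\<^sup>2 / 2)) = (\<Prod>b\<in>Basis. exp (- ((w \<bullet> b)\<^sup>2 / 2)))"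
proof -
  have "(norm w)\<^sup>2 = (\<Sum>b\<in>Basis. (w \<bullet> b)\<^sup>2)"
    by (subst power2_norm_eq_inner, subst euclidean_inner) (simp add: power2_eq_square)
  then show ?thesis
    by (simp add: exp_sum[symmetric] sum_divide_distrib sum_negf)
qed

lemma exp_square_eq_std_normal_density: "exp (- (x\<^sup>2 / 2)) = sqrt (2 * pi) * std_normal_density x"
  by (simp add: std_normal_density_def)

lemma integrable_gaussian_real: "integrable lborel (\<lambda>x::real. exp (- (x\<^sup>2 / 2)))"
  unfolding exp_square_eq_std_normal_density by simp

lemma integrable_gaussian: "integrable lborel (\<lambda>w::'a::euclidean_space. exp (- ((norm w)\<^sup>2 / 2)))"
  unfolding gaussian_prod_Basis by (intro integrable_lborel_prod integrable_gaussian_real)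

lemma integral_gaussian:
  "(\<integral>w. exp (- ((norm w)\<^sup>2 / 2)) \<partial>(lborel :: 'a::euclidean_space measure)) = sqrt (2 * pi) ^ DIM('a)"
proof -
  have "(\<integral>x. exp (- (x\<^sup>2 / 2)) \<partial>lborel) = sqrt (2 * pi)"
    unfolding exp_square_eq_std_normal_density by simp
  then show ?thesis
    unfolding gaussian_prod_Basis
    by (subst integral_lborel_prod[OF integrable_gaussian_real]) simp
qed

text \<open>Up to the factor \<open>sqrt (2 * pi)\<close> this is the characteristic function of the
  standard normal distribution.\<close>

lemma integral_gaussian_cis_real:
  "(\<integral>t. complex_of_real (exp (- (t\<^sup>2 / 2))) * cis (t * y) \<partial>lborel)
    = complex_of_real (sqrt (2 * pi) * exp (- (y\<^sup>2 / 2)))"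
proof -
  have "complex_of_real (exp (- (y\<^sup>2 / 2))) = char std_normal_distribution y"
    by (simp add: char_std_normal_distribution)
  also have "\<dots> = (\<integral>t. std_normal_density t *\<^sub>R iexp (y * t) \<partial>lborel)"
    unfolding char_def by (subst integral_density) auto
  finally have "(\<integral>t. std_normal_density t *\<^sub>R iexp (y * t) \<partial>lborel) = complex_of_real (exp (- (y\<^sup>2 / 2)))"
    by simp
  moreover have "complex_of_real (exp (- (t\<^sup>2 / 2))) * cis (t * y)
      = complex_of_real (sqrt (2 * pi)) * (std_normal_density t *\<^sub>R iexp (y * t))" for t
    unfolding exp_square_eq_std_normal_density
    by (simp add: scaleR_conv_of_real cis_conv_exp mult.commute)
  ultimately show ?thesis
    by (simp only: integral_mult_right_zero of_real_mult)
qed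

lemma integral_gaussian_cis:
  fixes x :: "'a::euclidean_space"
  shows "(\<integral>w. complex_of_real (exp (- ((norm w)\<^sup>2 / 2))) * cis (w \<bullet> x) \<partial>lborel)
    = complex_of_real (sqrt (2 * pi) ^ DIM('a) * exp (- ((norm x)\<^sup>2 / 2)))"
proof -
  have cis: "cis (w \<bullet> x) = (\<Prod>b\<in>Basis. cis ((w \<bullet> b) * (x \<bullet> b)))" for w :: 'a
    by (subst euclidean_inner) (simp add: cis_conv_exp sum_distrib_left exp_sum)
  have int: "integrable lborel (\<lambda>t. complex_of_real (exp (- (t\<^sup>2 / 2))) * cis (t * y))" for y
    by (rule Bochner_Integration.integrable_bound[OF integrable_gaussian_real])
      (auto simp: norm_mult cis_conv_exp)
  have "(\<integral>w. complex_of_real (exp (- ((norm w)\<^sup>2 / 2))) * cis (w \<bullet> x) \<partial>lborel)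
      = (\<integral>w. (\<Prod>b\<in>Basis. complex_of_real (exp (- ((w \<bullet> b)\<^sup>2 / 2))) * cis ((w \<bullet> b) * (x \<bullet> b))) \<partial>lborel)"
    unfolding gaussian_prod_Basis cis by (simp add: prod.distrib)
  also have "\<dots> = (\<Prod>b\<in>Basis. complex_of_real (sqrt (2 * pi) * exp (- ((x \<bullet> b)\<^sup>2 / 2))))"
    by (subst integral_lborel_prod[OF int]) (simp add: integral_gaussian_cis_real)
  finally show ?thesis
    unfolding gaussian_prod_Basis by (simp add: prod.distrib)
qed

text \<open>The Gaussian factor makes the double integral of \<open>h\<close> absolutely convergent,
  although \<open>\<phi>\<close> itself is not yet known to be integrable. By Fubini, integrating
  over \<open>y\<close> first yields \<open>\<phi>\<close>, while integrating over \<open>u\<close>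
  first yields a Gaussian average of \<open>f\<close> at scale \<open>s\<close> around
  \<open>x\<close>.\<close>

lemma
  fixes f \<phi> :: "'a::euclidean_space \<Rightarrow> real"
  assumes f: "integrable lborel f"
    and \<phi>: "\<And>u. complex_of_real (\<phi> u) = (\<integral>y. complex_of_real (f y) * cis (- (2 * pi * (u \<bullet> y))) \<partial>lborel)"
    and s: "s > 0"
  shows integrable_fourier_gaussian:
      "integrable lborel (\<lambda>u. \<phi> u * exp (- ((norm ((2 * pi * s) *\<^sub>R u))\<^sup>2 / 2)))"
    and integral_fourier_gaussian:
      "(\<integral>u. complex_of_real (\<phi> u * exp (- ((norm ((2 * pi * s) *\<^sub>R u))\<^sup>2 / 2))) * cis (2 * pi * (u \<bullet> x)) \<partial>lborel)
      = complex_of_real ((\<integral>z. f (x + s *\<^sub>R z) * exp (- ((norm z)\<^sup>2 / 2)) \<partial>lborel) / sqrt (2 * pi) ^ DIM('a))"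
proof -
  have [measurable]: "f \<in> borel_measurable borel"
    using borel_measurable_integrable[OF f] by simp
  define E where "E = (\<lambda>u::'a. exp (- ((norm ((2 * pi * s) *\<^sub>R u))\<^sup>2 / 2)))"
  have E_nonneg: "0 \<le> E u" for u
    by (simp add: E_def)
  have E: "integrable lborel E"
    using integrable_lborel_affine[of "2 * pi * s" "\<lambda>w::'a. exp (- ((norm w)\<^sup>2 / 2))" 0] s
    by (simp add: E_def integrable_gaussian del: norm_scaleR)
  have [measurable]: "E \<in> borel_measurable borel"
    using borel_measurable_integrable[OF E] by simp
  define h where "h = (\<lambda>x u y. complex_of_real (E u * f y) * cis (2 * pi * (u \<bullet> (x - y))))"
  have [measurable]: "case_prod (h x) \<in> borel_measurable (lborel \<Otimes>\<^sub>M lborel)" for x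
    unfolding h_def cis_conv_exp by measurable
  have norm_h: "norm (h x u y) = E u * \<bar>f y\<bar>" for x u y
    by (simp add: h_def norm_mult E_nonneg)
  have int_h: "integrable (lborel \<Otimes>\<^sub>M lborel) (case_prod (h x))" for x
  proof (rule lborel_pair.Fubini_integrable)
    show "integrable lborel (\<lambda>u. \<integral>y. norm (case_prod (h x) (u, y)) \<partial>lborel)"
      using E by (simp add: norm_h)
    have "integrable lborel (\<lambda>y. h x u y)" for u
    proof (rule Bochner_Integration.integrable_bound)
      show "integrable lborel (\<lambda>y. E u * f y)"
        using f by simp
      show "(\<lambda>y. h x u y) \<in> borel_measurable lborel"
        unfolding h_def cis_conv_exp by measurable
    qed (simp add: norm_h abs_mult E_nonneg)
    then show "AE u in lborel. integrable lborel (\<lambda>y. case_prod (h x) (u, y))"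
      by simp
  qed measurable
  have inner_y: "(\<integral>y. h x u y \<partial>lborel) = complex_of_real (\<phi> u * E u) * cis (2 * pi * (u \<bullet> x))" for x u
  proof -
    have "cis (2 * pi * (u \<bullet> x)) * cis (- (2 * pi * (u \<bullet> y))) = cis (2 * pi * (u \<bullet> (x - y)))" for y
      by (simp add: cis_mult inner_diff_right right_diff_distrib)
    then have "h x u y = (complex_of_real (E u) * cis (2 * pi * (u \<bullet> x))) * (complex_of_real (f y) * cis (- (2 * pi * (u \<bullet> y))))" for y
      unfolding h_def by (metis (no_types) mult.assoc mult.left_commute of_real_mult)
    then show ?thesis
      using \<phi>[of u] by simp
  qed
  have int1: "integrable lborel (\<lambda>u. complex_of_real (\<phi> u * E u) * cis (2 * pi * (u \<bullet> x)))" for x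
    using lborel_pair.integrable_fst[OF int_h[of x]] by (simp add: inner_y)
  \<comment> \<open>At \<open>x = 0\<close> the oscillating factor is 1.\<close>
  have "integrable lborel (\<lambda>u. Re (complex_of_real (\<phi> u * E u) * cis (2 * pi * (u \<bullet> 0))))"
    by (rule integrable_Re[OF int1])
  then show "integrable lborel (\<lambda>u. \<phi> u * exp (- ((norm ((2 * pi * s) *\<^sub>R u))\<^sup>2 / 2)))"
    by (simp add: E_def)
  have inner_u: "(\<integral>u. h x u y \<partial>lborel)
      = complex_of_real (f y * exp (- ((norm ((x - y) /\<^sub>R s))\<^sup>2 / 2)) * sqrt (2 * pi) ^ DIM('a) / (2 * pi * s) ^ DIM('a))" for y
  proof -
    let ?k = "\<lambda>w. complex_of_real (exp (- ((norm w)\<^sup>2 / 2))) * cis (w \<bullet> ((x - y) /\<^sub>R s))"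
    have k: "?k \<in> borel_measurable borel"
      unfolding cis_conv_exp by measurable
    have "(0 + (2 * pi * s) *\<^sub>R u) \<bullet> ((x - y) /\<^sub>R s) = 2 * pi * (u \<bullet> (x - y))" for u
      unfolding add_0_left inner_scaleR_left inner_scaleR_right using s by (simp add: field_simps)
    then have "h x u y = complex_of_real (f y) * ?k (0 + (2 * pi * s) *\<^sub>R u)" for u
      unfolding h_def E_def by (simp only: add_0_left of_real_mult mult_ac)
    then have "(\<integral>u. h x u y \<partial>lborel) = complex_of_real (f y) * (\<integral>u. ?k (0 + (2 * pi * s) *\<^sub>R u) \<partial>lborel)"
      by (simp only: integral_mult_right_zero)
    also have "(\<integral>u. ?k (0 + (2 * pi * s) *\<^sub>R u) \<partial>lborel) = integral\<^sup>L lborel ?k /\<^sub>R (2 * pi * s) ^ DIM('a)"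
      by (subst integral_lborel_affine[OF _ k, of "2 * pi * s" 0]) (use s in auto)
    also have "integral\<^sup>L lborel ?k = complex_of_real (sqrt (2 * pi) ^ DIM('a) * exp (- ((norm ((x - y) /\<^sub>R s))\<^sup>2 / 2)))"
      by (rule integral_gaussian_cis)
    finally show ?thesis
      by (simp add: scaleR_conv_of_real field_simps)
  qed
  \<comment> \<open>\<open>K\<close> collects the constant of the Gaussian transform and the
    Jacobian of \<open>u \<mapsto> (2 * pi * s) *\<^sub>R u\<close>. The Jacobian of the second
    substitution, with scale \<open>s\<close>, then leaves exactly the normalization of a Gaussian
    average.\<close>
  define K where "K = sqrt (2 * pi) ^ DIM('a) / (2 * pi * s) ^ DIM('a)"
  have "sqrt (2 * pi) ^ DIM('a) * sqrt (2 * pi) ^ DIM('a) = (2 * pi) ^ DIM('a)"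
    unfolding power_mult_distrib[symmetric] real_sqrt_mult_self by simp
  then have K: "\<bar>s\<bar> ^ DIM('a) * K = 1 / sqrt (2 * pi) ^ DIM('a)"
    using s by (simp add: K_def power_mult_distrib field_simps)
  let ?g = "\<lambda>y. f y * exp (- ((norm ((x - y) /\<^sub>R s))\<^sup>2 / 2))"
  have g: "?g \<in> borel_measurable borel"
    by measurable
  have "integral\<^sup>L lborel ?g = \<bar>s\<bar> ^ DIM('a) *\<^sub>R (\<integral>z. ?g (x + s *\<^sub>R z) \<partial>lborel)"
    by (rule integral_lborel_affine[OF _ g]) (use s in simp)
  also have "(\<lambda>z. ?g (x + s *\<^sub>R z)) = (\<lambda>z. f (x + s *\<^sub>R z) * exp (- ((norm z)\<^sup>2 / 2)))"
    using s by simp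
  finally have "integral\<^sup>L lborel ?g * K = (\<bar>s\<bar> ^ DIM('a) * K) * (\<integral>z. f (x + s *\<^sub>R z) * exp (- ((norm z)\<^sup>2 / 2)) \<partial>lborel)"
    by (simp only: real_scaleR_def mult_ac)
  then have sub: "integral\<^sup>L lborel ?g * K = (\<integral>z. f (x + s *\<^sub>R z) * exp (- ((norm z)\<^sup>2 / 2)) \<partial>lborel) / sqrt (2 * pi) ^ DIM('a)"
    unfolding K by simp
  have "(\<integral>u. complex_of_real (\<phi> u * E u) * cis (2 * pi * (u \<bullet> x)) \<partial>lborel)
      = (\<integral>u. (\<integral>y. h x u y \<partial>lborel) \<partial>lborel)"
    by (simp add: inner_y)
  also have "\<dots> = (\<integral>y. (\<integral>u. h x u y \<partial>lborel) \<partial>lborel)"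
    by (rule lborel_pair.Fubini_integral[OF int_h, symmetric])
  also have "\<dots> = (\<integral>y. complex_of_real (?g y * K) \<partial>lborel)"
    unfolding inner_u K_def by (simp add: mult.assoc)
  also have "\<dots> = complex_of_real (integral\<^sup>L lborel ?g * K)"
    by (simp only: integral_complex_of_real integral_mult_left_zero)
  finally show "(\<integral>u. complex_of_real (\<phi> u * exp (- ((norm ((2 * pi * s) *\<^sub>R u))\<^sup>2 / 2))) * cis (2 * pi * (u \<bullet> x)) \<partial>lborel)
      = complex_of_real ((\<integral>z. f (x + s *\<^sub>R z) * exp (- ((norm z)\<^sup>2 / 2)) \<partial>lborel) / sqrt (2 * pi) ^ DIM('a))"
    unfolding sub E_def .
qed

text \<open>Gaussian averages form an approximate identity: the integrands converge pointwise by
  continuity of \<open>f\<close> and are dominated by a bound of \<open>f\<close> times the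
  Gaussian.\<close>

lemma gaussian_average_tendsto:
  fixes f :: "'a::euclidean_space \<Rightarrow> real"
  assumes cont: "continuous_on UNIV f" and bdd: "bounded (range f)" and s: "s \<longlonglongrightarrow> 0"
  shows "(\<lambda>k. (\<integral>z. f (x + s k *\<^sub>R z) * exp (- ((norm z)\<^sup>2 / 2)) \<partial>lborel) / sqrt (2 * pi) ^ DIM('a)) \<longlonglongrightarrow> f x"
proof -
  obtain B where B: "\<And>x. \<bar>f x\<bar> \<le> B"
    using bdd unfolding bounded_iff by auto
  have [measurable]: "f \<in> borel_measurable borel"
    using cont by (rule borel_measurable_continuous_onI)
  have "(\<lambda>k. \<integral>z. f (x + s k *\<^sub>R z) * exp (- ((norm z)\<^sup>2 / 2)) \<partial>lborel)
      \<longlonglongrightarrow> (\<integral>z. f x * exp (- ((norm z)\<^sup>2 / 2)) \<partial>(lborel :: 'a measure))"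
  proof (rule integral_dominated_convergence)
    show "integrable (lborel :: 'a measure) (\<lambda>z. B * exp (- ((norm z)\<^sup>2 / 2)))"
      using integrable_gaussian[where 'a='a] by simp
    have "(\<lambda>k. f (x + s k *\<^sub>R z) * exp (- ((norm z)\<^sup>2 / 2))) \<longlonglongrightarrow> f x * exp (- ((norm z)\<^sup>2 / 2))" for z
    proof (intro tendsto_mult tendsto_const)
      have "(\<lambda>k. x + s k *\<^sub>R z) \<longlonglongrightarrow> x + 0 *\<^sub>R z"
        by (intro tendsto_intros s)
      moreover have "isCont f x"
        using cont by (simp add: continuous_on_eq_continuous_at)
      ultimately show "(\<lambda>k. f (x + s k *\<^sub>R z)) \<longlonglongrightarrow> f x"
        by (auto intro: isCont_tendsto_compose)
    qed
    then show "AE z in lborel. (\<lambda>k. f (x + s k *\<^sub>R z) * exp (- ((norm z)\<^sup>2 / 2))) \<longlonglongrightarrow> f x * exp (- ((norm z)\<^sup>2 / 2))"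
      by simp
  qed (auto simp: abs_mult intro: mult_right_mono B)
  then have "(\<lambda>k. (\<integral>z. f (x + s k *\<^sub>R z) * exp (- ((norm z)\<^sup>2 / 2)) \<partial>lborel) / sqrt (2 * pi) ^ DIM('a))
      \<longlonglongrightarrow> (f x * sqrt (2 * pi) ^ DIM('a)) / sqrt (2 * pi) ^ DIM('a)"
    by (intro tendsto_divide tendsto_const) (simp_all add: integral_gaussian)
  then show ?thesis
    by simp
qed

text \<open>As the scale shrinks, the factors \<open>E k\<close> increase to 1. Since
  \<open>\<phi>\<close> is nonnegative and the regularized integrals at \<open>x = 0\<close>
  converge to \<open>f 0\<close>, monotone convergence makes \<open>\<phi>\<close> integrable. It
  then dominates the regularized integrands, and dominated convergence gives inversion at every
  \<open>x\<close>.\<close>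

lemma
  fixes f \<phi> :: "'a::euclidean_space \<Rightarrow> real"
  assumes cont: "continuous_on UNIV f" and bdd: "bounded (range f)" and f: "integrable lborel f"
    and \<phi>: "\<And>u. complex_of_real (\<phi> u) = (\<integral>y. complex_of_real (f y) * cis (- (2 * pi * (u \<bullet> y))) \<partial>lborel)"
    and \<phi>_nonneg: "\<And>u. 0 \<le> \<phi> u"
  shows integrable_nonneg_fourier: "integrable lborel \<phi>"
    and fourier_inversion_nonneg:
      "complex_of_real (f x) = (\<integral>u. complex_of_real (\<phi> u) * cis (2 * pi * (u \<bullet> x)) \<partial>lborel)"
proof -
  define s where "s = (\<lambda>k. inverse (real (Suc k)))"
  define E where "E = (\<lambda>k u::'a. exp (- ((norm ((2 * pi * s k) *\<^sub>R u))\<^sup>2 / 2)))"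
  have E_nonneg: "0 \<le> E k u" for k u
    by (simp add: E_def)
  have s: "s \<longlonglongrightarrow> 0" and s_pos: "s k > 0" for k
    unfolding s_def by (rule LIMSEQ_inverse_real_of_nat) simp
  have int: "integrable lborel (\<lambda>u. \<phi> u * E k u)" for k
    unfolding E_def by (rule integrable_fourier_gaussian[OF f \<phi> s_pos])
  have lim: "(\<lambda>k. \<integral>u. complex_of_real (\<phi> u * E k u) * cis (2 * pi * (u \<bullet> x)) \<partial>lborel) \<longlonglongrightarrow> complex_of_real (f x)" for x
    unfolding E_def integral_fourier_gaussian[OF f \<phi> s_pos]
    by (intro tendsto_of_real gaussian_average_tendsto cont bdd s)
  have E_lim: "(\<lambda>k. E k u) \<longlonglongrightarrow> 1" for u
  proof -
    have "(\<lambda>k. E k u) \<longlonglongrightarrow> exp (- ((norm ((2 * pi * 0) *\<^sub>R u))\<^sup>2 / 2))"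
      unfolding E_def by (intro tendsto_intros s) simp
    then show ?thesis
      by simp
  qed
  have E_mono: "mono (\<lambda>k. E k u)" for u
  proof (rule monoI)
    fix j k :: nat
    assume "j \<le> k"
    then have "s k \<le> s j"
      by (simp add: s_def divide_simps)
    then have "(norm ((2 * pi * s k) *\<^sub>R u))\<^sup>2 \<le> (norm ((2 * pi * s j) *\<^sub>R u))\<^sup>2"
      using s_pos[of k] s_pos[of j]
      by (intro power_mono) (auto simp: abs_mult intro!: mult_right_mono)
    then show "E j u \<le> E k u"
      by (simp add: E_def del: norm_scaleR)
  qed
  \<comment> \<open>\<open>\<phi>\<close> is given only pointwise; it is measurable as the limit of
    the integrable functions in \<open>int\<close>.\<close>
  have \<phi>_meas[measurable]: "\<phi> \<in> borel_measurable borel"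
  proof -
    have "(\<lambda>k. \<phi> u * E k u) \<longlonglongrightarrow> \<phi> u" for u
      using tendsto_mult[OF tendsto_const[of "\<phi> u"] E_lim[of u]] by simp
    moreover have "(\<lambda>u. \<phi> u * E k u) \<in> borel_measurable borel" for k
      using borel_measurable_integrable[OF int[of k]] by simp
    ultimately show ?thesis
      by (rule borel_measurable_LIMSEQ_real)
  qed
  show int_\<phi>: "integrable lborel \<phi>"
  proof (rule integral_monotone_convergence_nonneg(1)[where f = "\<lambda>k u. \<phi> u * E k u"])
    show "AE u in lborel. mono (\<lambda>k. \<phi> u * E k u)"
      using E_mono \<phi>_nonneg by (intro AE_I2) (auto simp: mono_def intro: mult_left_mono)
    have "(\<lambda>k. Re (\<integral>u. complex_of_real (\<phi> u * E k u) * cis (2 * pi * (u \<bullet> 0)) \<partial>lborel)) \<longlonglongrightarrow> Re (complex_of_real (f 0))"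
      by (intro tendsto_Re lim)
    then show "(\<lambda>k. \<integral>u. \<phi> u * E k u \<partial>lborel) \<longlonglongrightarrow> f 0"
      by (simp del: of_real_mult add: integral_complex_of_real)
    have "(\<lambda>k. \<phi> u * E k u) \<longlonglongrightarrow> \<phi> u * 1" for u
      by (intro tendsto_intros E_lim)
    then show "AE u in lborel. (\<lambda>k. \<phi> u * E k u) \<longlonglongrightarrow> \<phi> u"
      by simp
  qed (use int \<phi>_nonneg E_nonneg in auto)
  have "(\<lambda>k. \<integral>u. complex_of_real (\<phi> u * E k u) * cis (2 * pi * (u \<bullet> x)) \<partial>lborel)
      \<longlonglongrightarrow> (\<integral>u. complex_of_real (\<phi> u) * cis (2 * pi * (u \<bullet> x)) \<partial>lborel)"
  proof (rule integral_dominated_convergence[OF _ _ int_\<phi>])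
    show "(\<lambda>u. complex_of_real (\<phi> u) * cis (2 * pi * (u \<bullet> x))) \<in> borel_measurable lborel"
      unfolding cis_conv_exp by measurable
    show "(\<lambda>u. complex_of_real (\<phi> u * E k u) * cis (2 * pi * (u \<bullet> x))) \<in> borel_measurable lborel" for k
      unfolding cis_conv_exp E_def by measurable
    have "(\<lambda>k. complex_of_real (\<phi> u * E k u) * cis (2 * pi * (u \<bullet> x))) \<longlonglongrightarrow> complex_of_real (\<phi> u * 1) * cis (2 * pi * (u \<bullet> x))" for u
      by (intro tendsto_intros E_lim)
    then show "AE u in lborel. (\<lambda>k. complex_of_real (\<phi> u * E k u) * cis (2 * pi * (u \<bullet> x)))
        \<longlonglongrightarrow> complex_of_real (\<phi> u) * cis (2 * pi * (u \<bullet> x))"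
      by simp
    show "AE u in lborel. norm (complex_of_real (\<phi> u * E k u) * cis (2 * pi * (u \<bullet> x))) \<le> \<phi> u" for k
    proof (rule AE_I2)
      fix u
      have "E k u \<le> 1"
        by (simp add: E_def)
      then show "norm (complex_of_real (\<phi> u * E k u) * cis (2 * pi * (u \<bullet> x))) \<le> \<phi> u"
        using \<phi>_nonneg[of u] E_nonneg[of k u] by (simp add: norm_mult mult_left_le)
    qed
  qed
  with lim show "complex_of_real (f x) = (\<integral>u. complex_of_real (\<phi> u) * cis (2 * pi * (u \<bullet> x)) \<partial>lborel)"
    by (rule LIMSEQ_unique)
qed

subsection \<open>Lower bound for the energy\<close>

text \<open>For the signed measure "counting measure on \<open>X\<close> minus \<open>c\<close>
  times \<open>M\<close>", inversion and Fubini turn the energy into the integral of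
  \<open>\<phi>\<close> times the squared modulus of the transform \<open>S - c * b\<close>. As
  \<open>f\<close> and \<open>\<phi>\<close> are real, \<open>f\<close> is even, which is why the
  two cross terms merge into one with factor 2.\<close>

lemma integral_discrepancy_nonneg:
  fixes f \<phi> :: "'a::euclidean_space \<Rightarrow> real" and X :: "'a set" and c :: real
  assumes \<phi>: "integrable lborel \<phi>" and \<phi>_nonneg: "\<And>u. 0 \<le> \<phi> u"
    and inv: "\<And>x. complex_of_real (f x) = (\<integral>u. complex_of_real (\<phi> u) * cis (2 * pi * (u \<bullet> x)) \<partial>lborel)"
    and X: "finite X" and M: "finite_measure M" "sets M = sets borel"
  shows "0 \<le> (\<Sum>x\<in>X. \<Sum>y\<in>X. f (x - y)) - 2 * c * (\<Sum>x\<in>X. \<integral>y. f (x - y) \<partial>M)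
    + c\<^sup>2 * (\<integral>x. (\<integral>y. f (x - y) \<partial>M) \<partial>M)"
proof -
  interpret M: finite_measure M
    by fact
  interpret P: pair_sigma_finite M "lborel :: 'a measure" ..
  note [measurable_cong] = M(2)
  have [measurable]: "\<phi> \<in> borel_measurable borel"
    using borel_measurable_integrable[OF \<phi>] by simp
  have [measurable]: "cnj \<in> borel_measurable borel"
    by (intro borel_measurable_continuous_onI continuous_intros)
  define e where "e = (\<lambda>u x::'a. cis (2 * pi * (u \<bullet> x)))"
  have e_meas[measurable]: "case_prod e \<in> borel_measurable (borel \<Otimes>\<^sub>M borel)"
    unfolding e_def cis_conv_exp by measurable
  have norm_e: "norm (e u x) = 1" for u x
    by (simp add: e_def)
  define b where "b = (\<lambda>u. \<integral>y. e u y \<partial>M)"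
  have b_meas[measurable]: "b \<in> borel_measurable borel"
    unfolding b_def by measurable
  have norm_b: "norm (b u) \<le> measure M (space M)" for u
    using integral_norm_bound[of M "e u"] by (simp add: b_def norm_e)
  have int_\<phi>: "integrable lborel (\<lambda>u. complex_of_real (\<phi> u) * k u)"
    if [measurable]: "k \<in> borel_measurable borel" and k: "\<And>u. norm (k u) \<le> K" for k K
  proof (rule Bochner_Integration.integrable_bound)
    show "integrable lborel (\<lambda>u. \<phi> u * K)"
      using \<phi> by simp
    show "AE u in lborel. norm (complex_of_real (\<phi> u) * k u) \<le> norm (\<phi> u * K)"
      using k \<phi>_nonneg by (intro AE_I2) (auto simp: norm_mult abs_mult intro!: mult_left_mono intro: order.trans[OF _ abs_ge_self])
  qed measurable
  \<comment> \<open>Fubini applies to every bounded kernel \<open>E\<close>, because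
    \<open>M\<close> is finite and \<open>\<phi>\<close> is integrable. The kernel has bound 1 for
    single exponentials and the total mass of \<open>M\<close> once \<open>b\<close> occurs.\<close>
  have swap: "(\<integral>y. (\<integral>u. complex_of_real (\<phi> u) * E u y \<partial>lborel) \<partial>M)
      = (\<integral>u. complex_of_real (\<phi> u) * (\<integral>y. E u y \<partial>M) \<partial>lborel)"
    if [measurable]: "case_prod E \<in> borel_measurable (borel \<Otimes>\<^sub>M borel)" and E: "\<And>u y. norm (E u y) \<le> K" for E K
  proof -
    have EK: "norm (E u y) \<le> \<bar>K\<bar>" for u y
      by (rule order.trans[OF E abs_ge_self])
    have "integrable (M \<Otimes>\<^sub>M lborel) (\<lambda>(y, u). complex_of_real (\<phi> u) * E u y)"
    proof (rule Bochner_Integration.integrable_bound)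
      show "integrable (M \<Otimes>\<^sub>M lborel) (\<lambda>(y, u). \<phi> u * K)"
      proof (rule P.Fubini_integrable)
        show "integrable M (\<lambda>y. \<integral>u. norm (case (y, u) of (y, u) \<Rightarrow> \<phi> u * K) \<partial>lborel)"
          by simp
        show "AE y in M. integrable lborel (\<lambda>u. case (y, u) of (y, u) \<Rightarrow> \<phi> u * K)"
          using \<phi> by simp
      qed measurable
      show "AE p in M \<Otimes>\<^sub>M lborel. norm (case p of (y, u) \<Rightarrow> complex_of_real (\<phi> u) * E u y)
          \<le> norm (case p of (y, u) \<Rightarrow> \<phi> u * K)"
        using EK \<phi>_nonneg by (intro AE_I2) (auto simp: norm_mult abs_mult intro!: mult_left_mono)
    qed measurable
    from P.Fubini_integral[OF this] show ?thesis
      by simp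
  qed
  have f_e: "complex_of_real (f (x - y)) = (\<integral>u. complex_of_real (\<phi> u) * (e u x * cnj (e u y)) \<partial>lborel)" for x y
    by (simp add: inv e_def cis_cnj cis_mult inner_diff_right right_diff_distrib)
  have cross: "complex_of_real (\<integral>y. f (x - y) \<partial>M)
      = (\<integral>u. complex_of_real (\<phi> u) * (e u x * cnj (b u)) \<partial>lborel)" for x
  proof -
    have "complex_of_real (\<integral>y. f (x - y) \<partial>M) = (\<integral>y. complex_of_real (f (x - y)) \<partial>M)"
      by simp
    also have "\<dots> = (\<integral>u. complex_of_real (\<phi> u) * (\<integral>y. e u x * cnj (e u y) \<partial>M) \<partial>lborel)"
      unfolding f_e by (rule swap[where K = 1]) (measurable, simp add: norm_mult norm_e)
    finally show ?thesis
      by (simp add: b_def)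
  qed
  have double: "complex_of_real (\<integral>x. (\<integral>y. f (x - y) \<partial>M) \<partial>M)
      = (\<integral>u. complex_of_real (\<phi> u) * (b u * cnj (b u)) \<partial>lborel)"
  proof -
    have "complex_of_real (\<integral>x. (\<integral>y. f (x - y) \<partial>M) \<partial>M) = (\<integral>x. complex_of_real (\<integral>y. f (x - y) \<partial>M) \<partial>M)"
      by (rule integral_complex_of_real[symmetric])
    also have "\<dots> = (\<integral>u. complex_of_real (\<phi> u) * (\<integral>x. e u x * cnj (b u) \<partial>M) \<partial>lborel)"
      unfolding cross
      by (rule swap[where K = "measure M (space M)"]) (measurable, simp add: norm_mult norm_e norm_b)
    finally show ?thesis
      by (simp add: b_def)
  qed
  define S where "S = (\<lambda>u. \<Sum>x\<in>X. e u x)"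
  have int1: "integrable lborel (\<lambda>u. complex_of_real (\<phi> u) * (e u x * cnj (e u y)))" for x y
    by (rule int_\<phi>[where K = 1]) (measurable, simp add: norm_mult norm_e)
  have int2: "integrable lborel (\<lambda>u. complex_of_real (\<phi> u) * (e u x * cnj (b u)))" for x
    by (rule int_\<phi>[where K = "measure M (space M)"]) (measurable, simp add: norm_mult norm_e norm_b)
  have int3: "integrable lborel (\<lambda>u. complex_of_real (\<phi> u) * (b u * cnj (b u)))"
    by (rule int_\<phi>[where K = "measure M (space M) * measure M (space M)"])
      (measurable, simp add: norm_mult norm_b mult_mono)
  let ?G = "\<lambda>u. (\<Sum>x\<in>X. \<Sum>y\<in>X. complex_of_real (\<phi> u) * (e u x * cnj (e u y)))
      - complex_of_real (2 * c) * (\<Sum>x\<in>X. complex_of_real (\<phi> u) * (e u x * cnj (b u)))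
      + complex_of_real (c\<^sup>2) * (complex_of_real (\<phi> u) * (b u * cnj (b u)))"
  \<comment> \<open>The cross terms \<open>S * cnj b\<close> and \<open>b * cnj S\<close> are
    conjugate, so twice the first has the same real part as their sum.\<close>
  have G: "Re (?G u) = \<phi> u * (norm (S u - complex_of_real c * b u))\<^sup>2" for u
  proof -
    have sum1: "(\<Sum>x\<in>X. \<Sum>y\<in>X. complex_of_real (\<phi> u) * (e u x * cnj (e u y))) = complex_of_real (\<phi> u) * (S u * cnj (S u))"
      unfolding S_def cnj_sum sum_product by (simp add: sum_distrib_left)
    have sum2: "(\<Sum>x\<in>X. complex_of_real (\<phi> u) * (e u x * cnj (b u))) = complex_of_real (\<phi> u) * (S u * cnj (b u))"
      by (simp add: S_def sum_distrib_left sum_distrib_right)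
    have "?G u = complex_of_real (\<phi> u) * (S u * cnj (S u) - complex_of_real (2 * c) * (S u * cnj (b u))
        + complex_of_real (c\<^sup>2) * (b u * cnj (b u)))"
      unfolding sum1 sum2 by (simp add: algebra_simps)
    also have "Re \<dots> = \<phi> u * (norm (S u - complex_of_real c * b u))\<^sup>2"
      unfolding cmod_power2 by (simp add: power2_eq_square algebra_simps)
    finally show ?thesis .
  qed
  have int_G: "integrable lborel ?G"
    by (intro Bochner_Integration.integrable_add Bochner_Integration.integrable_diff Bochner_Integration.integrable_sum
        integrable_mult_right int1 int2 int3)
  have "integral\<^sup>L lborel ?G
      = (\<Sum>x\<in>X. \<Sum>y\<in>X. complex_of_real (f (x - y)))
        - complex_of_real (2 * c) * (\<Sum>x\<in>X. complex_of_real (\<integral>y. f (x - y) \<partial>M))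
        + complex_of_real (c\<^sup>2) * complex_of_real (\<integral>x. (\<integral>y. f (x - y) \<partial>M) \<partial>M)"
    unfolding f_e cross double
    by (simp only: Bochner_Integration.integral_add Bochner_Integration.integral_diff Bochner_Integration.integral_sum
        integral_mult_right_zero int1 int2 int3 Bochner_Integration.integrable_add Bochner_Integration.integrable_diff
        Bochner_Integration.integrable_sum integrable_mult_right)
  also have "\<dots> = complex_of_real ((\<Sum>x\<in>X. \<Sum>y\<in>X. f (x - y)) - 2 * c * (\<Sum>x\<in>X. \<integral>y. f (x - y) \<partial>M)
    + c\<^sup>2 * (\<integral>x. (\<integral>y. f (x - y) \<partial>M) \<partial>M))"
    by (simp only: of_real_add of_real_diff of_real_mult of_real_sum)
  finally have eq: "integral\<^sup>L lborel ?G = complex_of_real ((\<Sum>x\<in>X. \<Sum>y\<in>X. f (x - y)) - 2 * c * (\<Sum>x\<in>X. \<integral>y. f (x - y) \<partial>M)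
    + c\<^sup>2 * (\<integral>x. (\<integral>y. f (x - y) \<partial>M) \<partial>M))" .
  have "0 \<le> (\<integral>u. Re (?G u) \<partial>lborel)"
    unfolding G by (intro Bochner_Integration.integral_nonneg) (simp add: \<phi>_nonneg)
  also have "\<dots> = Re (integral\<^sup>L lborel ?G)"
    by (rule integral_Re[OF int_G])
  finally show ?thesis
    unfolding eq by (simp only: Re_complex_of_real)
qed

text \<open>The strict inequality selects the complement of \<open>cball 0 T\<close>: this is the
  mass of \<open>f\<close> that can be missed when the integral is restricted to a set containing a
  closed ball of radius \<open>T\<close>.\<close>

definition tail_integral :: "('a::euclidean_space \<Rightarrow> real) \<Rightarrow> real \<Rightarrow> real" where
  "tail_integral f T = (\<integral>z. indicator {z. T < norm z} z * \<bar>f z\<bar> \<partial>lborel)"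

lemma tail_integral_tendsto_0:
  fixes f :: "'a::euclidean_space \<Rightarrow> real"
  assumes f: "integrable lborel f"
  shows "(tail_integral f \<longlongrightarrow> 0) at_top"
proof -
  have [measurable]: "f \<in> borel_measurable borel"
    using borel_measurable_integrable[OF f] by simp
  have "((\<lambda>T. \<integral>z. indicator {z. T < norm z} z * \<bar>f z\<bar> \<partial>lborel) \<longlongrightarrow> (\<integral>z. 0 \<partial>(lborel::'a measure))) at_top"
  proof (rule integral_dominated_convergence_at_top)
    show "integrable lborel (\<lambda>z. \<bar>f z\<bar>)"
      using f by simp
    have "((\<lambda>T. indicator {z. T < norm z} z * \<bar>f z\<bar>) \<longlongrightarrow> 0) at_top" for z
    proof (rule tendsto_eventually)
      show "\<forall>\<^sub>F T in at_top. indicator {z. T < norm z} z * \<bar>f z\<bar> = 0"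
        using eventually_ge_at_top[of "norm z"] by eventually_elim simp
    qed
    then show "AE z in lborel. ((\<lambda>T. indicator {z. T < norm z} z * \<bar>f z\<bar>) \<longlongrightarrow> 0) at_top"
      by simp
    show "\<forall>\<^sub>F T in at_top. AE z in lborel. norm (indicator {z. T < norm z} z * \<bar>f z\<bar>) \<le> \<bar>f z\<bar>"
      by (auto simp: indicator_def)
  qed measurable
  then show ?thesis
    by (simp add: tail_integral_def[abs_def])
qed

lemma integral_density_indicator:
  fixes g :: "'a \<Rightarrow> real"
  assumes "g \<in> borel_measurable M" "C \<in> sets M"
  shows "(\<integral>y. g y \<partial>density M (indicator C)) = (\<integral>y. indicator C y * g y \<partial>M)"
  using integral_real_density[of "indicator C" M g] assms by (simp add: ennreal_indicator)

text \<open>The substitution \<open>z = x - y\<close> moves the translation from \<open>f\<close> to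
  the indicator of \<open>C\<close>. If \<open>cball x T\<close> lies in \<open>C\<close>, that
  indicator is 1 for all \<open>z\<close> of norm at most \<open>T\<close>, so only the tail of
  \<open>f\<close> contributes to the difference.\<close>

lemma
  fixes f :: "'a::euclidean_space \<Rightarrow> real"
  assumes f: "integrable lborel f" and C: "C \<in> sets borel"
  shows abs_integral_translate_le: "\<bar>\<integral>y. f (x - y) \<partial>density lborel (indicator C)\<bar> \<le> (\<integral>z. \<bar>f z\<bar> \<partial>lborel)"
    and abs_integral_translate_diff_le:
      "cball x T \<subseteq> C \<Longrightarrow> \<bar>(\<integral>y. f (x - y) \<partial>density lborel (indicator C)) - integral\<^sup>L lborel f\<bar> \<le> tail_integral f T"
proof -
  have [measurable]: "f \<in> borel_measurable borel"
    using borel_measurable_integrable[OF f] by simp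
  note [measurable] = C
  have "(\<integral>y. f (x - y) \<partial>density lborel (indicator C)) = (\<integral>y. indicator C y * f (x - y) \<partial>lborel)"
    by (rule integral_density_indicator) measurable
  also have "\<dots> = (\<integral>z. indicator C (x - z) * f z \<partial>lborel)"
    by (subst integral_lborel_affine[of "-1" _ x]) auto
  finally have eq: "(\<integral>y. f (x - y) \<partial>density lborel (indicator C)) = (\<integral>z. indicator C (x - z) * f z \<partial>lborel)" .
  have int: "integrable lborel (\<lambda>z. g z * f z)"
    if [measurable]: "g \<in> borel_measurable borel" and g: "\<And>z. \<bar>g z\<bar> \<le> 1" for g
    by (rule Bochner_Integration.integrable_bound[OF f]) (use g in \<open>auto simp: abs_mult intro!: AE_I2 mult_left_le_one_le\<close>)
  have int1: "integrable lborel (\<lambda>z. indicator C (x - z) * f z)"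
    by (rule int) (auto simp: indicator_def)
  have "\<bar>\<integral>z. indicator C (x - z) * f z \<partial>lborel\<bar> \<le> (\<integral>z. \<bar>indicator C (x - z) * f z\<bar> \<partial>lborel)"
    by (rule integral_abs_bound)
  also have "\<dots> \<le> (\<integral>z. \<bar>f z\<bar> \<partial>lborel)"
    by (rule integral_mono) (use int1 f in \<open>auto simp: indicator_def\<close>)
  finally show "\<bar>\<integral>y. f (x - y) \<partial>density lborel (indicator C)\<bar> \<le> (\<integral>z. \<bar>f z\<bar> \<partial>lborel)"
    unfolding eq .
  assume sub: "cball x T \<subseteq> C"
  have "(\<integral>z. indicator C (x - z) * f z \<partial>lborel) - integral\<^sup>L lborel f
      = (\<integral>z. indicator C (x - z) * f z - f z \<partial>lborel)"
    by (rule Bochner_Integration.integral_diff[symmetric]) (rule int1 f)+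
  also have "\<bar>\<dots>\<bar> \<le> (\<integral>z. \<bar>indicator C (x - z) * f z - f z\<bar> \<partial>lborel)"
    by (rule integral_abs_bound)
  also have "\<dots> \<le> tail_integral f T"
    unfolding tail_integral_def
  proof (rule integral_mono)
    show "integrable lborel (\<lambda>z. \<bar>indicator C (x - z) * f z - f z\<bar>)"
      using int1 f by auto
    have "integrable lborel (\<lambda>z. \<bar>indicator {z. T < norm z} z * f z\<bar>)"
      by (intro integrable_abs int) (auto simp: indicator_def)
    then show "integrable lborel (\<lambda>z. indicator {z. T < norm z} z * \<bar>f z\<bar>)"
      by (simp add: abs_mult)
    show "\<bar>indicator C (x - z) * f z - f z\<bar> \<le> indicator {z. T < norm z} z * \<bar>f z\<bar>" for z
    proof (cases "norm z \<le> T")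
      case True
      then have "x - z \<in> C"
        using sub by (auto simp: dist_norm)
      then show ?thesis
        by simp
    qed (auto simp: indicator_def)
  qed
  finally show "\<bar>(\<integral>y. f (x - y) \<partial>density lborel (indicator C)) - integral\<^sup>L lborel f\<bar> \<le> tail_integral f T"
    unfolding eq .
qed

text \<open>The potential \<open>F\<close> of Lebesgue measure on \<open>C\<close> is within the
  tail \<open>d\<close> of the integral \<open>I\<close> on the inner ball, and is at most
  \<open>J\<close> in absolute value everywhere. Of the three tails in the bound, two come from the
  doubled cross term and one from the self-energy of \<open>C\<close>; the last term accounts for
  the shell between the two balls.\<close>

lemma energy_lower_bound:
  fixes f \<phi> :: "'a::euclidean_space \<Rightarrow> real" and X :: "'a set"
  assumes f: "integrable lborel f" and f_pos: "0 \<le> integral\<^sup>L lborel f"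
    and \<phi>: "integrable lborel \<phi>" and \<phi>_nonneg: "\<And>u. 0 \<le> \<phi> u"
    and inv: "\<And>x. complex_of_real (f x) = (\<integral>u. complex_of_real (\<phi> u) * cis (2 * pi * (u \<bullet> x)) \<partial>lborel)"
    and X: "finite X" "X \<subseteq> cball q R" and R: "0 \<le> R" and T: "0 < T"
  shows "(real (card X))\<^sup>2 / measure lborel (cball q (R + T))
      * (integral\<^sup>L lborel f - 3 * tail_integral f T - (\<integral>z. \<bar>f z\<bar> \<partial>lborel) * (1 - (R / (R + T)) ^ DIM('a)))
    \<le> (\<Sum>x\<in>X. \<Sum>y\<in>X. f (x - y))"
proof -
  define C where "C = cball q (R + T)"
  define V where "V = measure lborel C"
  define W where "W = measure lborel (cball q R)"
  define M where "M = density lborel (indicator C :: 'a \<Rightarrow> ennreal)"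
  define I where "I = integral\<^sup>L lborel f"
  define J where "J = (\<integral>z. \<bar>f z\<bar> \<partial>lborel)"
  define d where "d = tail_integral f T"
  define F where "F = (\<lambda>x. \<integral>y. f (x - y) \<partial>M)"
  have [measurable]: "f \<in> borel_measurable borel"
    using borel_measurable_integrable[OF f] by simp
  have C[measurable]: "C \<in> sets borel"
    by (simp add: C_def)
  have M: "sets M = sets borel"
    by (simp add: M_def)
  note [measurable_cong] = M
  have "emeasure M (space M) = emeasure lborel C"
    by (simp add: M_def emeasure_density)
  also have "\<dots> < \<infinity>"
    unfolding C_def by (rule emeasure_lborel_cball_finite)
  finally interpret M: finite_measure M
    by (intro finite_measureI) auto
  have V: "V > 0"
    using R T by (simp add: V_def C_def)
  have WV: "W = V * (R / (R + T)) ^ DIM('a)"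
    using R T by (simp add: V_def W_def C_def content_cball power_divide)
  have d_nonneg: "0 \<le> d"
    unfolding d_def tail_integral_def by (intro Bochner_Integration.integral_nonneg) simp
  have F1: "\<bar>F x - I\<bar> \<le> d" if "x \<in> cball q R" for x
  proof -
    have "cball x T \<subseteq> C"
    proof
      fix y
      assume "y \<in> cball x T"
      then show "y \<in> C"
        using that dist_triangle[of q y x] by (simp add: C_def)
    qed
    then show ?thesis
      unfolding F_def I_def d_def M_def by (rule abs_integral_translate_diff_le[OF f C])
  qed
  have F2: "\<bar>F x\<bar> \<le> J" for x
    unfolding F_def J_def M_def by (rule abs_integral_translate_le[OF f C])
  have [measurable]: "F \<in> borel_measurable borel"
    unfolding F_def by measurable
  have int_F: "integrable M F"
    by (rule M.integrable_const_bound[of _ J]) (use F2 in auto)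
  have "(\<integral>x. F x \<partial>M) = (\<integral>x. indicator C x * F x \<partial>lborel)"
    unfolding M_def by (rule integral_density_indicator) measurable
  \<comment> \<open>The majorant equals \<open>I + d\<close> on the inner ball and \<open>J\<close>
    on the rest of \<open>C\<close>.\<close>
  also have "\<dots> \<le> (\<integral>x. (I + d - J) * indicator (cball q R) x + J * indicator C x \<partial>lborel)"
  proof (rule integral_mono)
    have "integrable lborel (\<lambda>x. indicator C x *\<^sub>R F x)"
      using int_F unfolding M_def
      by (subst (asm) integrable_density[where g = "indicator C", unfolded ennreal_indicator]) auto
    then show "integrable lborel (\<lambda>x. indicator C x * F x)"
      by simp
    show "integrable lborel (\<lambda>x. (I + d - J) * indicator (cball q R) x + J * indicator C x)"
      unfolding C_def
      by (intro Bochner_Integration.integrable_add integrable_mult_right integrable_real_indicator)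
        (simp_all add: emeasure_lborel_cball_finite[unfolded infinity_ennreal_def])
    show "indicator C x * F x \<le> (I + d - J) * indicator (cball q R) x + J * indicator C x" for x
    proof (cases "x \<in> cball q R")
      case True
      then have "x \<in> C"
        using T by (simp add: C_def)
      with True F1[OF True] show ?thesis
        by (simp add: indicator_def)
    next
      case False
      then show ?thesis
        using F2[of x] by (simp add: indicator_def abs_le_iff)
    qed
  qed
  also have "\<dots> = (I + d - J) * W + J * V"
    unfolding V_def W_def C_def
    by (subst Bochner_Integration.integral_add)
      (auto intro!: integrable_mult_right integrable_real_indicator simp: emeasure_lborel_cball_finite[unfolded infinity_ennreal_def])
  \<comment> \<open>The left side is \<open>(I + d) * W + J * (V - W)\<close>. Enlarging
    \<open>W\<close> to \<open>V\<close> in the first summand uses \<open>0 \<le> I\<close>.\<close>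
  also have "\<dots> \<le> V * (I + d + J * (1 - (R / (R + T)) ^ DIM('a)))"
  proof -
    have "(R / (R + T)) ^ DIM('a) \<le> 1"
      using R T by (intro power_le_one) auto
    then have "W \<le> V"
      using V by (simp add: WV mult_left_le)
    then have "(I + d) * W \<le> (I + d) * V"
      using f_pos d_nonneg by (intro mult_left_mono) (auto simp: I_def)
    then show ?thesis
      by (simp add: WV algebra_simps)
  qed
  finally have dbl: "(\<integral>x. F x \<partial>M) \<le> V * (I + d + J * (1 - (R / (R + T)) ^ DIM('a)))" .
  define N where "N = real (card X)"
  have "N * (I - d) = (\<Sum>x\<in>X. I - d)"
    by (simp add: N_def)
  also have "\<dots> \<le> (\<Sum>x\<in>X. F x)"
    using F1 X(2) by (intro sum_mono) (force simp: abs_le_iff)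
  finally have crs: "N * (I - d) \<le> (\<Sum>x\<in>X. F x)" .
  \<comment> \<open>With this weight both measures have total mass \<open>N\<close>; it also
    minimizes the main term \<open>c\<^sup>2 * V * I - 2 * c * N * I\<close>.\<close>
  define c where "c = N / V"
  have c: "0 \<le> c"
    using V by (simp add: c_def N_def)
  have "0 \<le> (\<Sum>x\<in>X. \<Sum>y\<in>X. f (x - y)) - 2 * c * (\<Sum>x\<in>X. F x) + c\<^sup>2 * (\<integral>x. F x \<partial>M)"
    unfolding F_def
    by (rule integral_discrepancy_nonneg[OF \<phi> \<phi>_nonneg inv X(1) M.finite_measure_axioms M])
  also have "\<dots> \<le> (\<Sum>x\<in>X. \<Sum>y\<in>X. f (x - y)) - 2 * c * (N * (I - d))
      + c\<^sup>2 * (V * (I + d + J * (1 - (R / (R + T)) ^ DIM('a))))"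
    using c by (intro add_mono diff_mono mult_left_mono order.refl crs dbl) auto
  also have "\<dots> = (\<Sum>x\<in>X. \<Sum>y\<in>X. f (x - y))
      - N\<^sup>2 / V * (I - 3 * d - J * (1 - (R / (R + T)) ^ DIM('a)))"
    using V by (simp add: c_def power2_eq_square field_simps)
  finally show ?thesis
    by (simp add: N_def V_def C_def I_def d_def J_def)
qed

subsection \<open>Packings and the linear program\<close>

text \<open>Large balls contain all of \<open>X\<close>, so the averages are eventually constant.
  Hence every finite packing competes in the supremum \<open>max_average_degree\<close>.\<close>

lemma has_average_degree_finite:
  assumes X: "finite X"
  shows "has_average_degree \<epsilon> X ((\<Sum>x\<in>X. real (tangency_degree \<epsilon> X x)) / real (card X))"
  unfolding has_average_degree_def
proof (intro allI tendsto_eventually)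
  fix p :: "real^'a"
  obtain r0 where r0: "\<And>x. x \<in> X \<Longrightarrow> dist p x \<le> r0"
    using finite_imp_bounded[OF X] unfolding bounded_any_center[where a = p] by blast
  show "\<forall>\<^sub>F r in at_top. (\<Sum>x\<in>X \<inter> cball p r. real (tangency_degree \<epsilon> X x)) / real (card (X \<inter> cball p r))
      = (\<Sum>x\<in>X. real (tangency_degree \<epsilon> X x)) / real (card X)"
    using eventually_ge_at_top[of r0]
  proof eventually_elim
    case (elim r)
    have "dist p x \<le> r" if "x \<in> X" for x
      using r0[OF that] elim by linarith
    then have "X \<inter> cball p r = X"
      by auto
    then show ?case
      by simp
  qed
qed

lemma packing_centers_subset: "packing_centers \<rho> X \<Longrightarrow> Y \<subseteq> X \<Longrightarrow> packing_centers \<rho> Y"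
  unfolding packing_centers_def by (rule pairwise_subset)

text \<open>If two centers are closer than \<open>2 * \<rho>\<close>, their midpoint lies in both
  open balls.\<close>

lemma packing_centers_dist_iff:
  assumes "\<rho> > 0"
  shows "packing_centers \<rho> X \<longleftrightarrow> pairwise (\<lambda>x y. 2 * \<rho> \<le> dist x y) X"
proof -
  have "disjnt (ball x \<rho>) (ball y \<rho>) \<longleftrightarrow> 2 * \<rho> \<le> dist x y" for x y :: "real^'a"
  proof
    assume "2 * \<rho> \<le> dist x y"
    then show "disjnt (ball x \<rho>) (ball y \<rho>)"
      by (auto simp: disjnt_def intro!: disjoint_ballI)
  next
    assume disj: "disjnt (ball x \<rho>) (ball y \<rho>)"
    show "2 * \<rho> \<le> dist x y"
    proof (rule ccontr)
      assume "\<not> 2 * \<rho> \<le> dist x y"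
      then have "midpoint x y \<in> ball x \<rho> \<inter> ball y \<rho>"
        by (simp add: dist_midpoint)
      with disj show False
        by (auto simp: disjnt_def)
    qed
  qed
  then show ?thesis
    by (simp add: packing_centers_def)
qed

text \<open>Otherwise there would be an accumulation point \<open>l\<close>. A point
  \<open>x\<close> of the set within \<open>\<delta> / 2\<close> of \<open>l\<close> and another
  point strictly closer to \<open>l\<close> would then be less than \<open>\<delta>\<close>
  apart.\<close>

lemma separated_inter_cball_finite:
  fixes X :: "'a::euclidean_space set"
  assumes X: "pairwise (\<lambda>x y. \<delta> \<le> dist x y) X" and "\<delta> > 0"
  shows "finite (X \<inter> cball p r)"
proof (rule ccontr)
  assume "infinite (X \<inter> cball p r)"
  then obtain l where l: "l islimpt (X \<inter> cball p r)"
    using compact_eq_Bolzano_Weierstrass[of "cball p r"] by auto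
  then obtain x where x: "x \<in> X" "x \<noteq> l" "dist x l < \<delta> / 2"
    unfolding islimpt_approachable using \<open>\<delta> > 0\<close> by (meson IntE half_gt_zero)
  moreover have "0 < dist x l"
    using x by simp
  ultimately obtain y where y: "y \<in> X" "y \<noteq> l" "dist y l < dist x l"
    using l unfolding islimpt_approachable by (meson IntE)
  then have "x \<noteq> y"
    by auto
  then have "\<delta> \<le> dist x y"
    using X x y by (auto simp: pairwise_def)
  moreover have "dist x y \<le> dist x l + dist y l"
    by (rule dist_triangle2)
  ultimately show False
    using x y by linarith
qed

text \<open>The averaged shell counts \<open>A\<close> form a feasible point. The first
  \<open>k\<close> shells partition the distances in \<open>[1, 1 + \<epsilon> k)\<close>, so the
  \<open>k\<close>-th partial sum is the average degree of the tangency graph of \<open>X\<close>,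
  which \<open>U\<close> bounds. The objective at \<open>A\<close> dominates the energy per
  center.\<close>

lemma lp_energy_bound:
  fixes f :: "real^'n::finite \<Rightarrow> real" and X :: "(real^'n) set"
  assumes eps0: "\<epsilon> 0 = 0"
    and eps_mono: "\<And>k. k < m \<Longrightarrow> \<epsilon> k < \<epsilon> (Suc k)"
    and f_far: "\<And>x. norm x \<ge> 1 + \<epsilon> m \<Longrightarrow> f x \<le> 0"
    and eta_nonneg: "\<And>k. k \<in> {1..m} \<Longrightarrow> \<eta> k \<ge> 0"
    and f_near: "\<And>k x. k \<in> {1..m} \<Longrightarrow> norm x \<in> {1 + \<epsilon> (k - 1)..<1 + \<epsilon> k} \<Longrightarrow> f x \<le> \<eta> k"
    and U_bound: "\<And>k. k \<in> {1..m} \<Longrightarrow> ereal (U (\<epsilon> k)) \<ge> max_average_degree TYPE('n) (\<epsilon> k)"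
    and X: "finite X" "X \<noteq> {}" "packing_centers (1/2) X"
  shows "ereal ((\<Sum>x\<in>X. \<Sum>y\<in>X. f (x - y)) / real (card X)) \<le> lp_optimal_value m \<epsilon> U \<eta> (f 0)"
proof -
  define N where "N = real (card X)"
  have N: "N > 0"
    using X by (simp add: N_def card_gt_0_iff)
  define shell where "shell = (\<lambda>k x. {y\<in>X. dist x y \<in> {1 + \<epsilon> (k - 1)..<1 + \<epsilon> k}})"
  define A where "A = (\<lambda>k. (\<Sum>x\<in>X. real (card (shell k x))) / N)"
  have dist1: "1 \<le> dist x y" if "x \<in> X" "y \<in> X" "x \<noteq> y" for x y
    using X(3) that by (simp add: packing_centers_dist_iff pairwise_def)
  have degree: "real (tangency_degree (\<epsilon> k) X x) = (\<Sum>i=1..k. real (card (shell i x)))"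
    if "k \<le> m" "x \<in> X" for k x
  proof -
    have "real (card {y\<in>X. dist x y \<in> {1..<1 + \<epsilon> k}}) = (\<Sum>i=1..k. real (card (shell i x)))"
      using \<open>k \<le> m\<close>
    proof (induction k)
      case 0
      then show ?case
        by (simp add: eps0)
    next
      case (Suc k)
      \<comment> \<open>Nonnegativity of \<open>\<epsilon> k\<close> places the cut
        \<open>1 + \<epsilon> k\<close> inside the interval from 1 to
        \<open>1 + \<epsilon> (Suc k)\<close>.\<close>
      have "0 \<le> \<epsilon> j" if "j \<le> m" for j
        using that
      proof (induction j)
        case (Suc j)
        then show ?case
          using eps_mono[of j] by simp
      qed (simp add: eps0)
      then have "0 \<le> \<epsilon> k" "\<epsilon> k < \<epsilon> (Suc k)"
        using Suc.prems eps_mono[of k] by auto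
      then have "{y\<in>X. dist x y \<in> {1..<1 + \<epsilon> (Suc k)}} = {y\<in>X. dist x y \<in> {1..<1 + \<epsilon> k}} \<union> shell (Suc k) x"
        and "{y\<in>X. dist x y \<in> {1..<1 + \<epsilon> k}} \<inter> shell (Suc k) x = {}"
        by (auto simp: shell_def)
      then have "card {y\<in>X. dist x y \<in> {1..<1 + \<epsilon> (Suc k)}} = card {y\<in>X. dist x y \<in> {1..<1 + \<epsilon> k}} + card (shell (Suc k) x)"
        using X(1) by (simp add: card_Un_disjoint shell_def)
      then show ?case
        using Suc by simp
    qed
    then show ?thesis
      using that by (simp add: tangency_degree_def tangency_adj_def)
  qed
  have feas: "lp_feasible m \<epsilon> U A"
    unfolding lp_feasible_def
  proof (intro conjI ballI)
    fix k
    assume k: "k \<in> {1..m}"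
    have "(\<Sum>i=1..k. A i) = (\<Sum>x\<in>X. \<Sum>i=1..k. real (card (shell i x))) / N"
      unfolding A_def sum_divide_distrib[symmetric] by (subst sum.swap) simp
    also have "\<dots> = (\<Sum>x\<in>X. real (tangency_degree (\<epsilon> k) X x)) / real (card X)"
      using k by (simp add: degree N_def)
    also have "ereal \<dots> \<le> max_average_degree TYPE('n) (\<epsilon> k)"
      unfolding max_average_degree_def
      using has_average_degree_finite[OF X(1)] X(3) by (intro Sup_upper) blast
    also have "\<dots> \<le> ereal (U (\<epsilon> k))"
      by (rule U_bound[OF k])
    finally show "(\<Sum>i=1..k. A i) \<le> U (\<epsilon> k)"
      by simp
  next
    fix i
    show "0 \<le> A i"
      using N by (simp add: A_def sum_nonneg)
  qed
  have pair: "f (x - y) \<le> (if y = x then f 0 else 0) + (\<Sum>k=1..m. \<eta> k * indicator (shell k x) y)"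
    if xy: "x \<in> X" "y \<in> X" for x y
  proof -
    have sum_nonneg: "0 \<le> (\<Sum>k=1..m. \<eta> k * indicator (shell k x) y)"
      using eta_nonneg by (intro sum_nonneg) simp
    consider "x = y" | "x \<noteq> y" "dist x y \<ge> 1 + \<epsilon> m" | "x \<noteq> y" "dist x y < 1 + \<epsilon> m"
      by linarith
    then show ?thesis
    proof cases
      case 1
      then show ?thesis
        using sum_nonneg by simp
    next
      case 2
      then have "f (x - y) \<le> 0"
        by (intro f_far) (simp add: dist_norm)
      then show ?thesis
        using sum_nonneg 2 by simp
    next
      case 3
      \<comment> \<open>The least such index is the shell of \<open>y\<close>: minimality gives the
        lower endpoint, and index 0 is impossible since distinct centers have distance at least
        \<open>1 = 1 + \<epsilon> 0\<close>.\<close>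
      define k where "k = (LEAST k. dist x y < 1 + \<epsilon> k)"
      have k: "dist x y < 1 + \<epsilon> k"
        unfolding k_def using 3(2) by (rule LeastI)
      have km: "k \<le> m"
        unfolding k_def using 3(2) by (rule Least_le)
      have "k \<noteq> 0"
        using dist1[OF xy 3(1)] k eps0 by (intro notI) simp
      moreover from this have "\<not> dist x y < 1 + \<epsilon> (k - 1)"
        unfolding k_def by (intro not_less_Least) simp
      ultimately have k': "k \<in> {1..m}" "dist x y \<in> {1 + \<epsilon> (k - 1)..<1 + \<epsilon> k}"
        using k km by auto
      have "f (x - y) \<le> \<eta> k"
        using k' by (intro f_near) (simp_all add: dist_norm)
      also have "\<dots> = \<eta> k * indicator (shell k x) y"
        using k' xy by (simp add: shell_def)
      also have "\<dots> \<le> (\<Sum>k=1..m. \<eta> k * indicator (shell k x) y)"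
        using k' eta_nonneg by (intro member_le_sum) auto
      finally show ?thesis
        using 3 by simp
    qed
  qed
  have "(\<Sum>x\<in>X. \<Sum>y\<in>X. f (x - y))
      \<le> (\<Sum>x\<in>X. \<Sum>y\<in>X. (if y = x then f 0 else 0) + (\<Sum>k=1..m. \<eta> k * indicator (shell k x) y))"
    by (intro sum_mono pair)
  also have "\<dots> = (\<Sum>x\<in>X. f 0 + (\<Sum>k=1..m. \<eta> k * real (card (shell k x))))"
  proof (rule sum.cong[OF refl])
    fix x
    assume x: "x \<in> X"
    have "(\<Sum>y\<in>X. \<Sum>k=1..m. \<eta> k * indicator (shell k x) y) = (\<Sum>k=1..m. \<eta> k * (\<Sum>y\<in>X. indicator (shell k x) y))"
      by (subst sum.swap) (simp add: sum_distrib_left)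
    also have "\<dots> = (\<Sum>k=1..m. \<eta> k * real (card (shell k x)))"
    proof (intro sum.cong refl arg_cong2[where f = "(*)"])
      fix k
      have "X \<inter> shell k x = shell k x"
        by (auto simp: shell_def)
      then show "(\<Sum>y\<in>X. indicator (shell k x) y) = real (card (shell k x))"
        using X(1) by (simp add: indicator_def of_bool_def sum.If_cases)
    qed
    finally show "(\<Sum>y\<in>X. (if y = x then f 0 else 0) + (\<Sum>k=1..m. \<eta> k * indicator (shell k x) y))
        = f 0 + (\<Sum>k=1..m. \<eta> k * real (card (shell k x)))"
      using x X(1) by (simp add: sum.distrib)
  qed
  also have "\<dots> = N * (f 0 + (\<Sum>k=1..m. \<eta> k * A k))"
  proof -
    have "N * A k = (\<Sum>x\<in>X. real (card (shell k x)))" for k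
      using N by (simp add: A_def)
    then have "(\<Sum>x\<in>X. \<Sum>k=1..m. \<eta> k * real (card (shell k x))) = (\<Sum>k=1..m. \<eta> k * (N * A k))"
      by (subst sum.swap) (simp add: sum_distrib_left)
    then show ?thesis
      by (simp add: sum.distrib N_def ring_distribs sum_distrib_left mult.left_commute)
  qed
  finally have "(\<Sum>x\<in>X. \<Sum>y\<in>X. f (x - y)) / real (card X) \<le> f 0 + (\<Sum>k=1..m. \<eta> k * A k)"
    using N by (simp add: N_def pos_divide_le_eq mult.commute)
  then have "ereal ((\<Sum>x\<in>X. \<Sum>y\<in>X. f (x - y)) / real (card X)) \<le> ereal (f 0 + (\<Sum>k=1..m. \<eta> k * A k))"
    by simp
  also have "\<dots> \<le> lp_optimal_value m \<epsilon> U \<eta> (f 0)"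
    unfolding lp_optimal_value_def using feas by (intro SUP_upper) simp
  finally show ?thesis .
qed

subsection \<open>Densities\<close>

text \<open>Only balls with centers within \<open>r + \<rho>\<close> of \<open>p\<close> meet
  \<open>cball p r\<close>; comparing volumes cancels the volume of the unit ball.\<close>

lemma covered_fraction_le:
  fixes X :: "(real^'n::finite) set"
  assumes r: "0 < r" and \<rho>: "0 < \<rho>" and fin: "finite (X \<inter> cball p (r + \<rho>))"
  shows "covered_fraction (\<Union>x\<in>X. cball x \<rho>) p r \<le> real (card (X \<inter> cball p (r + \<rho>))) * (\<rho> / r) ^ CARD('n)"
proof -
  let ?Y = "X \<inter> cball p (r + \<rho>)"
  have sub: "cball p r \<inter> (\<Union>x\<in>X. cball x \<rho>) \<subseteq> (\<Union>x\<in>?Y. cball x \<rho>)"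
  proof
    fix z
    assume "z \<in> cball p r \<inter> (\<Union>x\<in>X. cball x \<rho>)"
    then obtain x where "x \<in> X" "dist p z \<le> r" "dist x z \<le> \<rho>"
      by auto
    moreover from this have "dist p x \<le> r + \<rho>"
      using dist_triangle2[of p x z] by linarith
    ultimately show "z \<in> (\<Union>x\<in>?Y. cball x \<rho>)"
      by auto
  qed
  let ?u = "unit_ball_vol (real CARD('n))"
  have "measure lborel (cball p r \<inter> (\<Union>x\<in>X. cball x \<rho>)) \<le> measure lborel (\<Union>x\<in>?Y. cball x \<rho>)"
  \<comment> \<open>On a non-measurable set \<open>measure\<close> takes the default value 0, so the
    bound holds in that case as well.\<close>
  proof (cases "cball p r \<inter> (\<Union>x\<in>X. cball x \<rho>) \<in> sets lborel")
    case True
    have "(\<Union>x\<in>?Y. cball x \<rho>) \<in> fmeasurable lborel"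
      using fin by (intro fmeasurable.finite_UN fmeasurable_compact) auto
    with True sub show ?thesis
      by (intro measure_mono_fmeasurable) auto
  qed (simp add: measure_notin_sets)
  also have "\<dots> \<le> (\<Sum>x\<in>?Y. measure lborel (cball x \<rho>))"
    using fin by (intro measure_UNION_le) auto
  also have "\<dots> = real (card ?Y) * (?u * \<rho> ^ CARD('n))"
    using \<rho> by (simp add: content_cball)
  finally have "covered_fraction (\<Union>x\<in>X. cball x \<rho>) p r
      \<le> real (card ?Y) * (?u * \<rho> ^ CARD('n)) / measure lborel (cball p r)"
    unfolding covered_fraction_def by (rule divide_right_mono) simp
  also have "measure lborel (cball p r) = ?u * r ^ CARD('n)"
    using r by (simp add: content_cball)
  also have "real (card ?Y) * (?u * \<rho> ^ CARD('n)) / \<dots> = real (card ?Y) * (\<rho> / r) ^ CARD('n)"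
    using r less_imp_neq[OF unit_ball_vol_pos[of "real CARD('n)"]] by (simp add: power_divide)
  finally show ?thesis .
qed

lemma upper_density_ge:
  assumes "has_density P \<Delta>"
  shows "ereal \<Delta> \<le> upper_density P"
proof -
  have "(covered_fraction P 0 \<longlongrightarrow> \<Delta>) at_top"
    using assms by (simp add: has_density_def)
  then have "((\<lambda>r. ereal (covered_fraction P 0 r)) \<longlongrightarrow> ereal \<Delta>) at_top"
    by simp
  then have "ereal \<Delta> = Limsup at_top (\<lambda>r. ereal (covered_fraction P 0 r))"
    by (intro lim_imp_Limsup[symmetric]) simp_all
  also have "\<dots> \<le> upper_density P"
    unfolding upper_density_def by (intro Limsup_mono always_eventually allI SUP_upper UNIV_I)
  finally show ?thesis .
qed

lemma dist_divideR:
  fixes x y :: "'a::real_normed_vector"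
  assumes "0 < c"
  shows "dist (x /\<^sub>R c) (y /\<^sub>R c) = dist x y / c"
  unfolding dist_norm scaleR_diff_right[symmetric] norm_scaleR
  using assms by (simp add: divide_inverse_commute)

lemma packing_centers_scale:
  assumes X: "packing_centers \<rho> X" and \<rho>: "0 < \<rho>"
  shows "packing_centers (1/2) ((\<lambda>x. x /\<^sub>R (2 * \<rho>)) ` X)"
proof -
  have \<rho>': "0 < 2 * \<rho>"
    using \<rho> by simp
  have "1 \<le> dist (x /\<^sub>R (2 * \<rho>)) (y /\<^sub>R (2 * \<rho>))" if "x \<in> X" "y \<in> X" "x \<noteq> y" for x y
    unfolding dist_divideR[OF \<rho>'] using X \<rho> that
    by (simp add: packing_centers_dist_iff pairwise_def)
  then show ?thesis
    by (auto simp: packing_centers_dist_iff pairwise_def)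
qed

text \<open>The \<open>N\<close> centers within \<open>r + \<rho>\<close> of \<open>p\<close>,
  scaled to radius \<open>1/2\<close>, have energy at most \<open>N * L\<close>, while
  \<open>energy_lower_bound\<close> is quadratic in \<open>N\<close>. Cancelling one
  \<open>N\<close> bounds the covered fraction by \<open>g r\<close>. This bound does not depend on
  \<open>p\<close>, so it passes to the supremum over \<open>p\<close>, and its limit is at most
  \<open>L\<close>.\<close>

lemma upper_density_le:
  fixes f \<phi> :: "real^'n::finite \<Rightarrow> real" and P :: "(real^'n) set"
  assumes f: "integrable lborel f"
    and f_vol: "measure lborel (cball (0 :: real^'n) (1/2)) \<le> integral\<^sup>L lborel f"
    and \<phi>: "integrable lborel \<phi>" and \<phi>_nonneg: "\<And>u. 0 \<le> \<phi> u"
    and inv: "\<And>x. complex_of_real (f x) = (\<integral>u. complex_of_real (\<phi> u) * cis (2 * pi * (u \<bullet> x)) \<partial>lborel)"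
    and L: "0 \<le> L"
    and energy: "\<And>Y. \<lbrakk>finite Y; Y \<noteq> {}; packing_centers (1/2) Y\<rbrakk> \<Longrightarrow>
      (\<Sum>x\<in>Y. \<Sum>y\<in>Y. f (x - y)) \<le> real (card Y) * L"
    and packing: "sphere_packing P"
  shows "upper_density P \<le> ereal L"
proof -
  obtain \<rho> X where \<rho>: "\<rho> > 0" and X: "packing_centers \<rho> X" and P: "P = (\<Union>x\<in>X. cball x \<rho>)"
    using packing unfolding sphere_packing_def by blast
  define n where "n = CARD('n)"
  define u where "u = unit_ball_vol (real n)"
  define I where "I = integral\<^sup>L lborel f"
  define J where "J = (\<integral>z. \<bar>f z\<bar> \<partial>lborel)"
  have u: "0 < u"
    by (simp add: u_def)
  have vol: "u * (1/2) ^ n \<le> I"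
    using f_vol by (simp add: content_cball u_def n_def I_def)
  then have I: "0 < I"
    using u by (meson less_le_trans mult_pos_pos zero_less_power half_gt_zero zero_less_one)
  \<comment> \<open>\<open>R r\<close> is the radius \<open>r + \<rho>\<close> after scaling by
    \<open>1 / (2 * \<rho>)\<close>. The margin \<open>T = sqrt r\<close> tends to infinity, which
    kills the tail, yet is negligible against \<open>R r\<close>, which kills the shell
    term.\<close>
  define R where "R = (\<lambda>r. (r + \<rho>) / (2 * \<rho>))"
  define err where "err = (\<lambda>r. I - 3 * tail_integral f (sqrt r) - J * (1 - (R r / (R r + sqrt r)) ^ n))"
  have err_lim: "(err \<longlongrightarrow> I) at_top"
  proof -
    have "((\<lambda>r. tail_integral f (sqrt r)) \<longlongrightarrow> 0) at_top"
      by (rule filterlim_compose[OF tail_integral_tendsto_0[OF f] sqrt_at_top])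
    moreover have "((\<lambda>r. R r / (R r + sqrt r)) \<longlongrightarrow> 1) at_top"
      unfolding R_def using \<rho> by real_asymp
    ultimately have "(err \<longlongrightarrow> I - 3 * 0 - J * (1 - 1 ^ n)) at_top"
      unfolding err_def by (intro tendsto_intros)
    then show ?thesis
      by simp
  qed
  \<comment> \<open>The powered quantity tends to \<open>1/2\<close>, so the limit of
    \<open>g\<close> is \<open>L\<close> times the volume of a ball of radius \<open>1/2\<close>,
    divided by \<open>I\<close>.\<close>
  define g where "g = (\<lambda>r. L * u * ((R r + sqrt r) * (\<rho> / r)) ^ n / err r)"
  have g_lim: "(g \<longlongrightarrow> L * u * (1/2) ^ n / I) at_top"
  proof -
    have "((\<lambda>r. (R r + sqrt r) * (\<rho> / r)) \<longlongrightarrow> 1/2) at_top"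
      unfolding R_def using \<rho> by real_asymp
    then show ?thesis
      unfolding g_def using I by (intro tendsto_intros err_lim) auto
  qed
  have bound: "covered_fraction P p r \<le> g r" if r: "0 < r" and e: "0 < err r" for p r
  proof -
    define Z where "Z = X \<inter> cball p (r + \<rho>)"
    define s where "s = (\<lambda>x::real^'n. x /\<^sub>R (2 * \<rho>))"
    have inj: "inj s"
      using \<rho> by (auto simp: s_def inj_def)
    have fin: "finite Z"
      unfolding Z_def using X \<rho>
      by (intro separated_inter_cball_finite[of "2 * \<rho>"]) (simp_all add: packing_centers_dist_iff)
    define N where "N = real (card Z)"
    have card: "real (card (s ` Z)) = N"
      using inj by (simp add: N_def card_image inj_on_subset)
    have R: "0 \<le> R r"
      using r \<rho> by (simp add: R_def)
    have frac: "covered_fraction P p r \<le> N * (\<rho> / r) ^ n"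
      unfolding P N_def Z_def n_def using fin by (intro covered_fraction_le r \<rho>) (simp add: Z_def)
    have "N * err r \<le> L * (u * (R r + sqrt r) ^ n)"
    \<comment> \<open>The hypothesis \<open>energy\<close> and the cancellation of \<open>N\<close>
      both require a nonempty set of centers.\<close>
    proof (cases "Z = {}")
      case True
      then show ?thesis
        using L u R r by (simp add: N_def)
    next
      case False
      then have N: "0 < N"
        using fin by (simp add: N_def card_gt_0_iff)
      have "s ` Z \<subseteq> cball (s p) (R r)"
      proof
        fix y
        assume "y \<in> s ` Z"
        then obtain x where x: "y = s x" "dist p x \<le> r + \<rho>"
          by (auto simp: Z_def)
        have "dist (s p) (s x) = dist p x / (2 * \<rho>)"
          unfolding s_def using \<rho> by (intro dist_divideR) simp
        also have "\<dots> \<le> R r"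
          unfolding R_def using x \<rho> by (intro divide_right_mono) auto
        finally show "y \<in> cball (s p) (R r)"
          by (simp add: x)
      qed
      then have "(real (card (s ` Z)))\<^sup>2 / measure lborel (cball (s p) (R r + sqrt r))
          * (integral\<^sup>L lborel f - 3 * tail_integral f (sqrt r)
            - (\<integral>z. \<bar>f z\<bar> \<partial>lborel) * (1 - (R r / (R r + sqrt r)) ^ DIM(real^'n)))
        \<le> (\<Sum>x\<in>s ` Z. \<Sum>y\<in>s ` Z. f (x - y))"
        using I fin R r by (intro energy_lower_bound[OF f _ \<phi> \<phi>_nonneg inv]) (simp_all add: I_def)
      also have "\<dots> \<le> real (card (s ` Z)) * L"
      proof (rule energy)
        have "packing_centers (1/2) (s ` X)"
          unfolding s_def by (rule packing_centers_scale[OF X \<rho>])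
        then show "packing_centers (1/2) (s ` Z)"
          by (rule packing_centers_subset) (auto simp: Z_def)
      qed (use fin False in auto)
      finally have "N\<^sup>2 / (u * (R r + sqrt r) ^ n) * err r \<le> N * L"
        unfolding card using R r by (simp add: content_cball u_def n_def err_def I_def J_def)
      then have "N * (N * err r / (u * (R r + sqrt r) ^ n)) \<le> N * L"
        by (simp add: power2_eq_square)
      then have "N * err r / (u * (R r + sqrt r) ^ n) \<le> L"
        using N by (simp only: mult_le_cancel_left_pos)
      moreover have "0 < u * (R r + sqrt r) ^ n"
        using u R r by (intro mult_pos_pos zero_less_power add_nonneg_pos) auto
      ultimately show ?thesis
        by (simp only: pos_divide_le_eq)
    qed
    then have "N \<le> L * (u * (R r + sqrt r) ^ n) / err r"
      using e by (simp only: pos_le_divide_eq)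
    then have "N * (\<rho> / r) ^ n \<le> L * (u * (R r + sqrt r) ^ n) / err r * (\<rho> / r) ^ n"
      using \<rho> r by (intro mult_right_mono) auto
    also have "\<dots> = g r"
      unfolding g_def power_mult_distrib by (simp add: mult_ac)
    finally show ?thesis
      using frac by linarith
  qed
  have "\<forall>\<^sub>F r in at_top. (SUP p. ereal (covered_fraction P p r)) \<le> ereal (g r)"
    using eventually_gt_at_top[of 0] order_tendstoD(1)[OF err_lim I]
    by eventually_elim (simp add: SUP_le_iff bound)
  then have "upper_density P \<le> Limsup at_top (\<lambda>r. ereal (g r))"
    unfolding upper_density_def by (rule Limsup_mono)
  also have "\<dots> = ereal (L * u * (1/2) ^ n / I)"
    using g_lim by (intro lim_imp_Limsup) auto
  \<comment> \<open>Here the condition that the transform at 0 is at least the volume of the ball,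
    in the form \<open>vol\<close>, enters.\<close>
  also have "\<dots> \<le> ereal L"
    using mult_left_mono[OF vol L] I by (simp add: pos_divide_le_eq mult.assoc)
  finally show ?thesis .
qed

theorem theorem1p4:
  fixes f :: "real^'n::finite \<Rightarrow> real"
    and m :: nat
    and \<epsilon> \<eta> :: "nat \<Rightarrow> real"
    and U :: "real \<Rightarrow> real"
    and P :: "(real^'n) set"
  assumes eps0: "\<epsilon> 0 = 0"
    and eps_mono: "\<And>k. k < m \<Longrightarrow> \<epsilon> k < \<epsilon> (Suc k)"
    and f_schwartz: "schwartz f"
    and hat_zero: "fourier f 0 \<in> \<real>" "Re (fourier f 0) \<ge> measure lborel (cball (0 :: real^'n) (1/2))"
    and hat_nonneg: "\<And>u. u \<noteq> 0 \<Longrightarrow> fourier f u \<in> \<real> \<and> Re (fourier f u) \<ge> 0"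
    and f_far: "\<And>x. norm x \<ge> 1 + \<epsilon> m \<Longrightarrow> f x \<le> 0"
    and eta_nonneg: "\<And>k. k \<in> {1..m} \<Longrightarrow> \<eta> k \<ge> 0"
    and f_near: "\<And>k x. k \<in> {1..m} \<Longrightarrow> norm x \<in> {1 + \<epsilon> (k - 1)..<1 + \<epsilon> k} \<Longrightarrow> f x \<le> \<eta> k"
    and U_bound: "\<And>k. k \<in> {1..m} \<Longrightarrow> ereal (U (\<epsilon> k)) \<ge> max_average_degree TYPE('n) (\<epsilon> k)"
    and packing: "sphere_packing P"
  shows "upper_density P \<le> lp_optimal_value m \<epsilon> U \<eta> (f 0) \<and>
         (\<forall>\<Delta>. has_density P \<Delta> \<longrightarrow> ereal \<Delta> \<le> lp_optimal_value m \<epsilon> U \<eta> (f 0))"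
proof -
  define \<phi> where "\<phi> = (\<lambda>u. Re (fourier f u))"
  have real: "fourier f u \<in> \<real>" for u
    using hat_zero hat_nonneg by (cases "u = 0") auto
  have \<phi>_nonneg: "0 \<le> \<phi> u" for u
    using hat_zero(2) hat_nonneg by (cases "u = 0") (auto simp: \<phi>_def intro: order.trans[OF measure_nonneg])
  have fourier_cis: "fourier f u = (\<integral>y. complex_of_real (f y) * cis (- (2 * pi * (u \<bullet> y))) \<partial>lborel)" for u
    by (simp add: fourier_def cis_conv_exp mult_ac)
  have \<phi>: "complex_of_real (\<phi> u) = (\<integral>y. complex_of_real (f y) * cis (- (2 * pi * (u \<bullet> y))) \<partial>lborel)" for u
    using real[of u] unfolding fourier_cis[symmetric] \<phi>_def by (simp add: of_real_Re)
  note f = schwartz_continuous[OF f_schwartz] schwartz_bounded[OF f_schwartz] schwartz_integrable[OF f_schwartz]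
  note int_\<phi> = integrable_nonneg_fourier[OF f \<phi> \<phi>_nonneg]
  note inv = fourier_inversion_nonneg[OF f \<phi> \<phi>_nonneg]
  have "complex_of_real (integral\<^sup>L lborel f) = fourier f 0"
    by (simp add: fourier_cis)
  then have f_int: "integral\<^sup>L lborel f = Re (fourier f 0)"
    by (metis Re_complex_of_real)
  let ?L = "lp_optimal_value m \<epsilon> U \<eta> (f 0)"
  have energy: "ereal ((\<Sum>x\<in>Y. \<Sum>y\<in>Y. f (x - y)) / real (card Y)) \<le> ?L"
    if "finite Y" "Y \<noteq> {}" "packing_centers (1/2) Y" for Y
    using that by (intro lp_energy_bound eps0 eps_mono f_far eta_nonneg f_near U_bound)
  \<comment> \<open>Inversion at 0 shows \<open>f 0 \<ge> 0\<close>, and the packing with a single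
    ball has energy \<open>f 0\<close>. Together they give \<open>0 \<le> ?L\<close>.\<close>
  have "complex_of_real (f 0) = complex_of_real (integral\<^sup>L lborel \<phi>)"
    by (simp add: inv[of 0])
  then have "0 \<le> f 0"
    using \<phi>_nonneg by (simp only: of_real_eq_iff) (intro Bochner_Integration.integral_nonneg, simp)
  moreover have "ereal (f 0) \<le> ?L"
    using energy[of "{0}"] by (simp add: packing_centers_def)
  ultimately have L_nonneg: "0 \<le> ?L"
    by (metis ereal_less_eq(5) order.trans)
  have "upper_density P \<le> ?L"
  \<comment> \<open>The value is an extended real: plus infinity makes the claim trivial, and minus
    infinity, the value of an infeasible program, is excluded by \<open>L_nonneg\<close>.\<close>
  proof (cases ?L)
    case (real L)
    have "upper_density P \<le> ereal L"
    proof (rule upper_density_le[OF f(3) _ int_\<phi> \<phi>_nonneg inv _ _ packing])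
      show "measure lborel (cball (0 :: real^'n) (1/2)) \<le> integral\<^sup>L lborel f"
        using hat_zero(2) by (simp add: f_int)
      show "0 \<le> L"
        using L_nonneg real by simp
      fix Y :: "(real^'n) set"
      assume Y: "finite Y" "Y \<noteq> {}" "packing_centers (1/2) Y"
      then have "0 < real (card Y)"
        by (simp add: card_gt_0_iff)
      then show "(\<Sum>x\<in>Y. \<Sum>y\<in>Y. f (x - y)) \<le> real (card Y) * L"
        using energy[OF Y] real by (simp add: pos_divide_le_eq mult.commute)
    qed
    then show ?thesis
      by (simp add: real)
  qed (use L_nonneg in auto)
  then show ?thesis
    using upper_density_ge order.trans by blast
qed

end
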